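(* Let $(W,S)$ be a finite Coxeter system and $u,v\in W$ with $u\leq v$. Then every face of the Bruhat interval polytope $\Delta_{[u,v]}(p)$ is a Bruhat interval polytope $\Delta_{[x,y]}(p)$, for some $x,y\in W$ with $u\leq x\leq y\leq v$.
   Context: $W$ is identified with the finite reflection group acting on the real vector space $V$ of its standard geometric representation, with simple roots $\alpha_s$ and invariant inner product $(\cdot,\cdot)$; $\leq$ is Bruhat order and $[x,y]=\{z: x\leq z\leq y\}$. Fix $p\in V$ with $(p,\alpha_s)<0$ for all $s\in S$. For $x\leq y$, the Bruhat interval polytope $\Delta_{[x,y]}(p)$ is the convex hull of $\{z(p): z\in[x,y]\}$. *)

theory Defs
  imports "HOL-Analysis.Analysis"
begin

text \<open>A Coxeter matrix indexed by the finite type 'i of simple generators S.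
  Entries are natural numbers (infinite entries never occur for finite W).\<close>
definition coxeter_matrix :: "('i \<Rightarrow> 'i \<Rightarrow> nat) \<Rightarrow> bool" where
  "coxeter_matrix m \<longleftrightarrow> (\<forall>i. m i i = 1) \<and> (\<forall>i j. m i j = m j i)
      \<and> (\<forall>i j. i \<noteq> j \<longrightarrow> m i j \<ge> 2)"

text \<open>Standard geometric representation: V = real^'i with basis the simple roots
  alpha_s = axis s 1 and bilinear form B(alpha_s, alpha_t) = - cos (pi / m s t).\<close>
definition sroot :: "'i::finite \<Rightarrow> real^'i" where
  "sroot s = axis s 1"

definition cform :: "('i::finite \<Rightarrow> 'i \<Rightarrow> nat) \<Rightarrow> real^'i \<Rightarrow> real^'i \<Rightarrow> real" where
  "cform m x y = (\<Sum>a\<in>UNIV. \<Sum>b\<in>UNIV. x$a * y$b * (- cos (pi / real (m a b))))"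

definition sref :: "('i::finite \<Rightarrow> 'i \<Rightarrow> nat) \<Rightarrow> 'i \<Rightarrow> real^'i \<Rightarrow> real^'i" where
  "sref m s v = v - (2 * cform m (sroot s) v) *\<^sub>R sroot s"

definition word_elem :: "('i::finite \<Rightarrow> 'i \<Rightarrow> nat) \<Rightarrow> 'i list \<Rightarrow> real^'i \<Rightarrow> real^'i" where
  "word_elem m xs = foldr (\<lambda>s f. sref m s \<circ> f) xs id"

definition coxW :: "('i::finite \<Rightarrow> 'i \<Rightarrow> nat) \<Rightarrow> (real^'i \<Rightarrow> real^'i) set" where
  "coxW m = range (word_elem m)"

definition clength :: "('i::finite \<Rightarrow> 'i \<Rightarrow> nat) \<Rightarrow> (real^'i \<Rightarrow> real^'i) \<Rightarrow> nat" where
  "clength m w = (LEAST n. \<exists>xs. length xs = n \<and> word_elem m xs = w)"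

definition crefl :: "('i::finite \<Rightarrow> 'i \<Rightarrow> nat) \<Rightarrow> (real^'i \<Rightarrow> real^'i) set" where
  "crefl m = {word_elem m xs \<circ> sref m s \<circ> word_elem m (rev xs) | xs s. True}"

text \<open>Bruhat order (Bjorner--Brenti Def. 2.1.1): reflexive-transitive closure of
  x \<rightarrow> x t with t a reflection and l(x) < l(x t).\<close>
definition bruhat_step :: "('i::finite \<Rightarrow> 'i \<Rightarrow> nat) \<Rightarrow> ((real^'i \<Rightarrow> real^'i) \<times> (real^'i \<Rightarrow> real^'i)) set" where
  "bruhat_step m = {(x, x \<circ> t) | x t. x \<in> coxW m \<and> t \<in> crefl m \<and> clength m x < clength m (x \<circ> t)}"

definition bruhat_le :: "('i::finite \<Rightarrow> 'i \<Rightarrow> nat) \<Rightarrow> (real^'i \<Rightarrow> real^'i) \<Rightarrow> (real^'i \<Rightarrow> real^'i) \<Rightarrow> bool" where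
  "bruhat_le m x y \<longleftrightarrow> x \<in> coxW m \<and> (x, y) \<in> (bruhat_step m)\<^sup>*"

definition bruhat_interval :: "('i::finite \<Rightarrow> 'i \<Rightarrow> nat) \<Rightarrow> (real^'i \<Rightarrow> real^'i) \<Rightarrow> (real^'i \<Rightarrow> real^'i) \<Rightarrow> (real^'i \<Rightarrow> real^'i) set" where
  "bruhat_interval m x y = {z. bruhat_le m x z \<and> bruhat_le m z y}"

definition BIP :: "('i::finite \<Rightarrow> 'i \<Rightarrow> nat) \<Rightarrow> (real^'i \<Rightarrow> real^'i) \<Rightarrow> (real^'i \<Rightarrow> real^'i) \<Rightarrow> real^'i \<Rightarrow> (real^'i) set" where
  "BIP m x y p = convex hull ((\<lambda>z. z p) ` bruhat_interval m x y)"

end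

theory Submission
  imports Defs "HOL-Computational_Algebra.Polynomial"
begin

text \<open>A face of the polytope is cut out by a linear functional \<open>l\<close>; let \<open>A\<close> be the set of
  \<open>z \<in> [u,v]\<close> minimizing \<open>l (z p)\<close>. Write the \<open>R\<close>-polynomials as a sum over the paths in the
  Bruhat graph that are increasing for a reflection order (this only needs that left and right
  multiplication in the Hecke algebra commute); since they are monic of degree
  \<open>\<ell>(v) - \<ell>(u)\<close>, every Bruhat interval has exactly one increasing saturated chain. For an order
  in which the roots with \<open>l < 0\<close> come first, \<open>l (z p)\<close> first decreases and then increases along
  such a chain, and uniqueness forces all chains through an element of \<open>A\<close> to turn at the same
  \<open>x \<in> A\<close>, from which every \<open>z \<in> A\<close> is reached by reflections in roots with \<open>l = 0\<close>; dually
  \<open>A\<close> has a greatest element \<open>y\<close>. Finally, induction on \<open>\<ell>(y)\<close> with the lifting property shows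
  that one saturated chain inside a coset of the stabilizer of \<open>l\<close> forces the whole interval
  \<open>[x,y]\<close> into this coset, so \<open>A = [x,y]\<close>.\<close>

section \<open>The standard geometric representation and the group of the simple reflections\<close>

locale coxeter_rep =
  fixes m :: "'i::finite \<Rightarrow> 'i \<Rightarrow> nat"
  assumes coxeter: "coxeter_matrix m"
begin

abbreviation "B \<equiv> cform m"
abbreviation "S \<equiv> sref m"
abbreviation "elem \<equiv> word_elem m"
abbreviation "W \<equiv> coxW m"
abbreviation "len \<equiv> clength m"

lemma m_sym: "m a b = m b a" and m_refl [simp]: "m a a = 1"
  and m_ge2: "a \<noteq> b \<Longrightarrow> m a b \<ge> 2"
  using coxeter by (auto simp: coxeter_matrix_def)

lemma B_sym: "B x y = B y x"
proof -
  have "B x y = (\<Sum>b\<in>UNIV. \<Sum>a\<in>UNIV. x$a * y$b * (- cos (pi / real (m a b))))"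
    unfolding cform_def by (rule sum.swap)
  also have "\<dots> = B y x"
    unfolding cform_def by (intro sum.cong refl) (simp add: m_sym mult.commute mult.left_commute)
  finally show ?thesis .
qed

lemma linear_B: "linear (B x)"
proof (rule linearI)
  show "B x (y + z) = B x y + B x z" for y z
    by (simp only: cform_def vector_add_component distrib_left distrib_right sum.distrib)
  show "B x (c *\<^sub>R y) = c *\<^sub>R B x y" for c y
    by (simp add: cform_def sum_distrib_left algebra_simps)
qed

lemma B_add_right: "B x (y + z) = B x y + B x z"
  and B_diff_right: "B x (y - z) = B x y - B x z"
  and B_scale_right: "B x (c *\<^sub>R y) = c * B x y"
  and B_minus_right: "B x (- y) = - B x y"
  using linear_B[of x] by (simp_all add: linear_add linear_diff linear_scale linear_neg)

lemma B_add_left: "B (y + z) x = B y x + B z x"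
  and B_diff_left: "B (y - z) x = B y x - B z x"
  and B_scale_left: "B (c *\<^sub>R y) x = c * B y x"
  and B_minus_left: "B (- y) x = - B y x"
  using B_add_right B_diff_right B_scale_right B_minus_right by (simp_all add: B_sym[of _ x])

lemmas B_simps = B_add_right B_diff_right B_scale_right B_minus_right
  B_add_left B_diff_left B_scale_left B_minus_left

lemma B_sroot: "B (sroot a) (sroot b) = - cos (pi / real (m a b))"
proof -
  have "B (sroot a) (sroot b) = (\<Sum>a'\<in>UNIV. \<Sum>b'\<in>UNIV. if a' = a \<and> b' = b then - cos (pi / real (m a b)) else 0)"
    unfolding cform_def sroot_def axis_def by (intro sum.cong refl) auto
  also have "\<dots> = (\<Sum>a'\<in>UNIV. if a' = a then - cos (pi / real (m a b)) else 0)"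
    by (intro sum.cong refl) (auto simp: sum.delta)
  finally show ?thesis by simp
qed

lemma B_sroot_self [simp]: "B (sroot a) (sroot a) = 1"
  by (simp add: B_sroot)

lemma sum_sroot: "x = (\<Sum>a\<in>UNIV. (x $ a) *\<^sub>R sroot a)"
  by (simp add: vec_eq_iff sroot_def axis_def if_distrib cong: if_cong)

text \<open>There is no division by \<open>B b b\<close>, so this is an orthogonal reflection only
  if \<open>B b b = 1\<close>; roots satisfy this by \<open>B_root\<close>.\<close>

definition reflect :: "real^'i \<Rightarrow> real^'i \<Rightarrow> real^'i" where
  "reflect b v = v - (2 * B b v) *\<^sub>R b"

lemma sref_eq_refl: "S s = reflect (sroot s)"
  by (simp add: fun_eq_iff sref_def reflect_def)

lemma linear_refl: "linear (reflect b)"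
  unfolding reflect_def by (rule linearI) (simp_all add: B_simps algebra_simps)

lemma refl_minus [simp]: "reflect (- b) = reflect b"
  by (simp add: fun_eq_iff reflect_def B_simps)

lemma refl_self: "B b b = 1 \<Longrightarrow> reflect b b = - b"
  by (simp add: reflect_def vec_eq_iff)

lemma refl_invol: "B b b = 1 \<Longrightarrow> reflect b \<circ> reflect b = id"
  by (simp add: fun_eq_iff reflect_def B_simps algebra_simps)

lemma B_refl: "B b b = 1 \<Longrightarrow> B (reflect b x) (reflect b y) = B x y"
  by (simp add: reflect_def B_simps B_sym[of x b] algebra_simps)

lemma linear_S: "linear (S s)"
  by (simp add: sref_eq_refl linear_refl)

lemma S_invol [simp]: "S s \<circ> S s = id"
  by (simp add: sref_eq_refl refl_invol)

lemma S_S [simp]: "S s (S s x) = x"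
  using S_invol by (metis comp_apply id_apply)

lemma comp_S_S [simp]: "f \<circ> S s \<circ> S s = f"
  by (simp add: fun_eq_iff)

lemma S_sroot: "S s (sroot s) = - sroot s"
  by (simp add: sref_eq_refl refl_self)

lemma elem_Nil [simp]: "elem [] = id"
  and elem_Cons [simp]: "elem (s # xs) = S s \<circ> elem xs"
  by (simp_all add: word_elem_def)

lemma elem_append [simp]: "elem (xs @ ys) = elem xs \<circ> elem ys"
  by (induction xs) (simp_all add: comp_assoc)

lemma elem_rev: "elem (rev xs) \<circ> elem xs = id" "elem xs \<circ> elem (rev xs) = id"
proof -
  have *: "elem (rev xs) \<circ> elem xs = id" for xs
  proof (induction xs)
    case (Cons s xs)
    have "elem (rev (s # xs)) \<circ> elem (s # xs) = elem (rev xs) \<circ> (S s \<circ> S s) \<circ> elem xs"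
      by (simp add: comp_assoc del: S_invol)
    also have "\<dots> = id" using Cons by (simp only: S_invol comp_id)
    finally show ?case .
  qed simp
  show "elem (rev xs) \<circ> elem xs = id" "elem xs \<circ> elem (rev xs) = id"
    using *[of xs] *[of "rev xs"] by simp_all
qed

lemma elem_in_W [simp]: "elem xs \<in> W"
  by (simp add: coxW_def)

lemma W_E: assumes "w \<in> W" obtains xs where "w = elem xs"
  using assms by (auto simp: coxW_def)

lemma id_in_W [simp]: "id \<in> W"
  by (metis elem_Nil elem_in_W)

lemma S_in_W [simp]: "S s \<in> W"
  using elem_in_W[of "[s]"] by simp

lemma comp_in_W [simp]: "x \<in> W \<Longrightarrow> y \<in> W \<Longrightarrow> x \<circ> y \<in> W"
  by (metis W_E elem_append elem_in_W)

lemma bij_W: "w \<in> W \<Longrightarrow> bij w"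
  by (metis W_E elem_rev o_bij)

lemma inv_elem: "inv (elem xs) = elem (rev xs)"
  using elem_rev by (metis inv_unique_comp)

lemma inv_in_W [simp]: "w \<in> W \<Longrightarrow> inv w \<in> W"
  by (metis W_E elem_in_W inv_elem)

lemma inv_comp_W [simp]: "w \<in> W \<Longrightarrow> inv w \<circ> w = id" "w \<in> W \<Longrightarrow> w \<circ> inv w = id"
  by (metis W_E elem_rev inv_elem)+

lemma inv_app_W: "w \<in> W \<Longrightarrow> inv w (w x) = x"
  by (metis inv_comp_W(1) comp_apply id_apply)

lemma app_inv_W: "w \<in> W \<Longrightarrow> w (inv w x) = x"
  by (metis inv_comp_W(2) comp_apply id_apply)

lemma inv_S [simp]: "inv (S s) = S s"
  by (simp add: inv_unique_comp)

lemma inv_comp: "x \<in> W \<Longrightarrow> y \<in> W \<Longrightarrow> inv (x \<circ> y) = inv y \<circ> inv x"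
  by (simp add: bij_W o_inv_distrib)

lemma linear_W: "w \<in> W \<Longrightarrow> linear w"
proof -
  have "linear (elem xs)" for xs
    by (induction xs) (simp_all only: elem_Nil elem_Cons linear_id linear_compose linear_S)
  then show "w \<in> W \<Longrightarrow> linear w" by (metis W_E)
qed

lemma W_minus: "w \<in> W \<Longrightarrow> w (- x) = - w x"
  by (simp add: linear_W linear_neg)

lemma B_W: "w \<in> W \<Longrightarrow> B (w x) (w y) = B x y"
proof -
  have "B (elem xs x) (elem xs y) = B x y" for xs
    by (induction xs) (simp_all add: sref_eq_refl B_refl)
  then show "w \<in> W \<Longrightarrow> B (w x) (w y) = B x y" by (metis W_E)
qed

text \<open>A consequence of the invariance of \<open>B\<close>; it moves reflections from one side
  of a group element to the other.\<close>

lemma refl_conj: "w \<in> W \<Longrightarrow> w \<circ> reflect b = reflect (w b) \<circ> w"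
  by (simp add: fun_eq_iff reflect_def B_W linear_W linear_diff linear_scale)

lemma len_le: "len (elem xs) \<le> length xs"
  unfolding clength_def by (rule Least_le) auto

lemma reduced_word: assumes "w \<in> W" obtains xs where "elem xs = w" "length xs = len w"
proof -
  have "\<exists>xs. length xs = len w \<and> elem xs = w"
    unfolding clength_def by (rule LeastI_ex) (use assms in \<open>auto simp: coxW_def\<close>)
  with that show ?thesis by blast
qed

lemma len_id [simp]: "len id = 0"
  using len_le[of "[]"] by simp

lemma len_0: "w \<in> W \<Longrightarrow> len w = 0 \<Longrightarrow> w = id"
  by (metis elem_Nil length_0_conv reduced_word)

lemma len_comp_S: "w \<in> W \<Longrightarrow> len (w \<circ> S s) \<le> Suc (len w)"
  by (metis reduced_word[of w] len_le[of "_ @ [s]"] elem_append elem_Cons elem_Nil comp_id length_append_singleton)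

lemma len_le_comp_S: "w \<in> W \<Longrightarrow> len w \<le> Suc (len (w \<circ> S s))"
  using len_comp_S[of "w \<circ> S s" s] by simp

lemma len_comp_elem: "w \<in> W \<Longrightarrow> len (w \<circ> elem xs) \<le> len w + length xs"
  by (metis reduced_word[of w] len_le[of "_ @ xs"] elem_append length_append)

lemma exists_descent: assumes "w \<in> W" "w \<noteq> id" obtains s where "len (w \<circ> S s) < len w"
proof -
  obtain xs where xs: "elem xs = w" "length xs = len w" using reduced_word assms by blast
  with assms have "xs \<noteq> []" by auto
  then obtain ys s where ys: "xs = ys @ [s]" by (metis rev_exhaust)
  have "w \<circ> S s = elem ys" using xs ys by auto
  with that[of s] len_le[of ys] xs ys show ?thesis by simp
qed

subsection \<open>Positive and negative roots\<close>

text \<open>The zero vector counts as positive; roots are nonzero, so on them exactly one of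
  \<open>b\<close> and \<open>- b\<close> is positive (\<open>pos_minus\<close>).\<close>

definition pos :: "real^'i \<Rightarrow> bool" where
  "pos v \<longleftrightarrow> (\<forall>i. 0 \<le> v $ i)"

section \<open>Alternating words and dihedral subgroups\<close>

fun altw :: "'i \<Rightarrow> 'i \<Rightarrow> nat \<Rightarrow> 'i list" where
  "altw s t 0 = []"
| "altw s t (Suc k) = altw t s k @ [t]"

lemma altw_Suc_left: "altw s t (Suc k) = (if even k then t else s) # altw s t k"
proof (induction k arbitrary: s t)
  case (Suc k)
  have "altw s t (Suc (Suc k)) = altw t s (Suc k) @ [t]" by simp
  also have "\<dots> = (if even k then s else t) # altw t s k @ [t]"
    by (simp only: Suc append_Cons)
  finally show ?case by simp
qed simp

lemma length_altw [simp]: "length (altw s t k) = k"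
  by (induction s t k rule: altw.induct) auto

lemma set_altw: "set (altw s t k) \<subseteq> {s, t}"
  by (induction s t k rule: altw.induct) auto

lemma S_sroot_other: "S t (sroot s) = sroot s + (2 * cos (pi / m s t)) *\<^sub>R sroot t"
  by (simp add: sref_def B_sroot m_sym)

text \<open>Each new letter on the left realizes the recurrence sin((k+2)\<theta>) = 2 cos \<theta>
  sin((k+1)\<theta>) - sin(k\<theta>). The factor \<open>sin \<theta>\<close> keeps the formula free
  of divisions.\<close>

lemma altw_sroot:
  fixes s t :: 'i
  defines "\<theta> \<equiv> pi / m s t"
  shows "sin \<theta> *\<^sub>R elem (altw s t k) (sroot s) =
    sin ((real k + 1) * \<theta>) *\<^sub>R sroot (if even k then s else t)
    + sin (k * \<theta>) *\<^sub>R sroot (if even k then t else s)"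
proof (induction k)
  case (Suc k)
  let ?l = "if even k then s else t" and ?o = "if even k then t else s"
  have c: "cos (pi / m ?l ?o) = cos \<theta>" by (simp add: \<theta>_def m_sym)
  have trig: "2 * cos \<theta> * sin ((real k + 1) * \<theta>) = sin ((real k + 2) * \<theta>) + sin (k * \<theta>)"
  proof -
    have "(real k + 2) * \<theta> = (real k + 1) * \<theta> + \<theta>" "real k * \<theta> = (real k + 1) * \<theta> - \<theta>"
      by (simp_all add: algebra_simps)
    then show ?thesis by (simp only: sin_add sin_diff) simp
  qed
  have "sin \<theta> *\<^sub>R elem (altw s t (Suc k)) (sroot s) = S ?o (sin \<theta> *\<^sub>R elem (altw s t k) (sroot s))"
    by (simp only: altw_Suc_left elem_Cons comp_apply linear_scale[OF linear_S])
  also have "\<dots> = S ?o (sin ((real k + 1) * \<theta>) *\<^sub>R sroot ?l + sin (k * \<theta>) *\<^sub>R sroot ?o)"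
    by (simp only: Suc)
  also have "\<dots> = sin ((real k + 1) * \<theta>) *\<^sub>R (sroot ?l + (2 * cos \<theta>) *\<^sub>R sroot ?o) - sin (k * \<theta>) *\<^sub>R sroot ?o"
    by (simp only: linear_add[OF linear_S] linear_scale[OF linear_S]
        S_sroot_other[of ?o ?l] c S_sroot) simp
  also have "\<dots> = sin ((real k + 1) * \<theta>) *\<^sub>R sroot ?l + (2 * cos \<theta> * sin ((real k + 1) * \<theta>) - sin (k * \<theta>)) *\<^sub>R sroot ?o"
    by (simp only: scaleR_add_right scaleR_scaleR scaleR_diff_left) (simp add: mult_ac)
  also have "\<dots> = sin ((real k + 2) * \<theta>) *\<^sub>R sroot ?o + sin ((real k + 1) * \<theta>) *\<^sub>R sroot ?l"
    unfolding trig by simp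
  finally show ?case by (simp add: add_ac)
qed simp

lemma sin_angle_pos: "s \<noteq> t \<Longrightarrow> sin (pi / m s t) > 0"
  using m_ge2[of s t] by (intro sin_gt_zero) (auto simp: field_simps)

text \<open>By \<open>altw_sroot\<close>, the words \<open>altw s t\<close> of lengths
  \<open>m s t - 1\<close> and \<open>m s t\<close> send \<open>sroot s\<close> to opposite vectors.
  The word \<open>altw t s (m s t)\<close> is the shorter one with \<open>s\<close> appended, and
  \<open>s\<close> negates \<open>sroot s\<close>.\<close>

lemma braid_sroot:
  assumes "s \<noteq> t"
  shows "elem (altw s t (m s t)) (sroot s) = elem (altw t s (m s t)) (sroot s)"
proof -
  obtain M where M: "m s t = Suc M" using m_ge2[OF assms] by (cases "m s t") auto
  define \<theta> where "\<theta> = pi / m s t"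
  have M\<theta>: "real (Suc M) * \<theta> = pi" by (simp add: \<theta>_def M)
  have 0: "sin \<theta> > 0" using sin_angle_pos[OF assms] by (simp add: \<theta>_def)
  have a: "sin ((real (Suc M) + 1) * \<theta>) = - sin \<theta>" "sin (real M * \<theta>) = sin \<theta>"
    "sin (Suc M * \<theta>) = 0" "sin ((real M + 1) * \<theta>) = 0"
  proof -
    have "(real (Suc M) + 1) * \<theta> = pi + \<theta>" "real M * \<theta> = pi - \<theta>" "(real M + 1) * \<theta> = pi"
      using M\<theta> by (simp_all add: algebra_simps)
    then show "sin ((real (Suc M) + 1) * \<theta>) = - sin \<theta>" "sin (real M * \<theta>) = sin \<theta>"
      "sin (Suc M * \<theta>) = 0" "sin ((real M + 1) * \<theta>) = 0"
      using M\<theta> by (simp_all only: sin_add sin_diff) simp_all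
  qed
  have "sin \<theta> *\<^sub>R elem (altw s t (Suc M)) (sroot s) = - sin \<theta> *\<^sub>R sroot (if even M then t else s)"
    using altw_sroot[of s t "Suc M"] a by (simp only: flip: \<theta>_def) simp
  moreover have "sin \<theta> *\<^sub>R elem (altw s t M) (sroot s) = sin \<theta> *\<^sub>R sroot (if even M then t else s)"
    using altw_sroot[of s t M] a by (simp only: flip: \<theta>_def) simp
  ultimately have "elem (altw s t (Suc M)) (sroot s) = - sroot (if even M then t else s)"
    "elem (altw s t M) (sroot s) = sroot (if even M then t else s)"
    using 0 by (simp_all only: scaleR_cancel_left scaleR_minus_left flip: scaleR_minus_right) simp_all
  then show ?thesis
    by (simp add: M S_sroot W_minus)
qed

lemma elem_fixes_orthogonal:
  "(\<And>s. s \<in> set xs \<Longrightarrow> B (sroot s) v = 0) \<Longrightarrow> elem xs v = v"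
  by (induction xs) (simp_all add: sref_def)

text \<open>Both sides are linear, agree on the two simple roots and fix everything orthogonal to
  them. These vectors span, because the Gram determinant of the two roots is the square of a nonzero
  sine.\<close>

lemma braid:
  assumes "s \<noteq> t"
  shows "elem (altw s t (m s t)) = elem (altw t s (m s t))"
proof
  fix v
  define c where "c = cos (pi / m s t)"
  define d where "d = 1 - c\<^sup>2"
  have "d \<noteq> 0" using sin_angle_pos[OF assms] by (simp add: d_def c_def cos_squared_eq)
  \<comment> \<open>\<open>x\<close> and \<open>y\<close> solve the Gram system, with determinant
    \<open>d\<close>, that makes \<open>u\<close> orthogonal to both simple roots.\<close>
  define x where "x = (B (sroot s) v + c * B (sroot t) v) / d"
  define y where "y = (B (sroot t) v + c * B (sroot s) v) / d"
  define u where "u = v - x *\<^sub>R sroot s - y *\<^sub>R sroot t"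
  have "B (sroot s) u = B (sroot s) v - x + c * y" "B (sroot t) u = B (sroot t) v + c * x - y"
    by (simp_all add: u_def B_simps B_sroot c_def m_sym)
  moreover have "x * d = B (sroot s) v + c * B (sroot t) v" "y * d = B (sroot t) v + c * B (sroot s) v"
    using \<open>d \<noteq> 0\<close> by (simp_all add: x_def y_def)
  then have "(B (sroot s) v - x + c * y) * d = 0" "(B (sroot t) v + c * x - y) * d = 0"
    by (auto simp: d_def) algebra+
  ultimately have u: "B (sroot s) u = 0" "B (sroot t) u = 0"
    using \<open>d \<noteq> 0\<close> by auto
  have fu: "elem (altw s t k) u = u" "elem (altw t s k) u = u" for k
    using set_altw[of s t k] set_altw[of t s k] u by (auto intro!: elem_fixes_orthogonal)
  have v: "v = x *\<^sub>R sroot s + y *\<^sub>R sroot t + u" by (simp add: u_def)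
  show "elem (altw s t (m s t)) v = elem (altw t s (m s t)) v"
    using braid_sroot[OF assms] braid_sroot[OF assms[symmetric]] fu
    by (simp add: v linear_add[OF linear_W] linear_scale[OF linear_W] m_sym)
qed

text \<open>For \<open>k < m s t\<close> the angles k\<theta> and (k+1)\<theta> in
  \<open>altw_sroot\<close> lie between 0 and \<pi>.\<close>

lemma altw_sroot_nonneg:
  assumes "s \<noteq> t" "k < m s t"
  obtains a b where "a \<ge> 0" "b \<ge> 0" "elem (altw s t k) (sroot s) = a *\<^sub>R sroot s + b *\<^sub>R sroot t"
proof -
  define \<theta> where "\<theta> = pi / m s t"
  have \<theta>: "\<theta> \<ge> 0" "m s t * \<theta> = pi" using assms by (simp_all add: \<theta>_def)
  have pos: "sin (j * \<theta>) \<ge> 0" if "j \<le> m s t" for j :: nat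
    using mult_right_mono[of "real j" "m s t" \<theta>] that \<theta> by (intro sin_ge_zero) auto
  have 0: "sin \<theta> > 0" using sin_angle_pos[OF assms(1)] by (simp add: \<theta>_def)
  have "elem (altw s t k) (sroot s) = (1 / sin \<theta>) *\<^sub>R (sin \<theta> *\<^sub>R elem (altw s t k) (sroot s))"
    using 0 by simp
  also have "\<dots> = (1 / sin \<theta>) *\<^sub>R (sin ((real k + 1) * \<theta>) *\<^sub>R sroot (if even k then s else t)
    + sin (k * \<theta>) *\<^sub>R sroot (if even k then t else s))"
    by (simp only: \<theta>_def altw_sroot)
  finally have e: "elem (altw s t k) (sroot s) =
      (sin ((real k + 1) * \<theta>) / sin \<theta>) *\<^sub>R sroot (if even k then s else t)
    + (sin (k * \<theta>) / sin \<theta>) *\<^sub>R sroot (if even k then t else s)"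
    by (simp add: scaleR_add_right)
  have "0 \<le> sin ((real k + 1) * \<theta>) / sin \<theta>" "0 \<le> sin (k * \<theta>) / sin \<theta>"
    using pos[of k] pos[of "k+1"] assms 0 by (auto simp: add.commute)
  with e that show ?thesis
    by (cases "even k") (auto simp: add.commute)
qed

text \<open>Two equal neighbouring letters would cancel, so a shortest word in two letters
  alternates.\<close>

lemma reduced_dihedral_word:
  assumes "set xs \<subseteq> {s, t}" "\<And>ys. elem ys = elem xs \<Longrightarrow> length xs \<le> length ys"
    and "xs = [] \<or> last xs = t"
  shows "xs = altw s t (length xs)"
  using assms
proof (induction xs arbitrary: s t rule: rev_induct)
  case (snoc a ys)
  have "ys = altw t s (length ys)"
  proof (rule snoc.IH)
    show "set ys \<subseteq> {t, s}" using snoc.prems by auto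
    show "length ys \<le> length zs" if "elem zs = elem ys" for zs
      using snoc.prems(2)[of "zs @ [a]"] that by simp
    show "ys = [] \<or> last ys = s"
    proof (rule ccontr)
      assume "\<not> ?thesis"
      moreover from this have "last ys \<in> {s, t}"
        using snoc.prems(1) last_in_set[of ys] by (simp del: last_in_set) blast
      ultimately have "ys \<noteq> []" "last ys = a" using snoc.prems by auto
      then obtain zs where "ys = zs @ [a]" by (metis append_butlast_last_id)
      with snoc.prems(2)[of zs] show False by simp
    qed
  qed
  with snoc.prems show ?case by simp
qed simp

text \<open>Factor \<open>w = v \<circ> x\<close> with \<open>x\<close> in a dihedral subgroup, \<open>s\<close> among its generators, and \<open>v\<close> as short
  as possible; the dihedral factor is handled by \<open>altw_sroot_nonneg\<close>, and \<open>v\<close> by induction.\<close>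

theorem pos_of_ascent:
  assumes "w \<in> W" "len w \<le> len (w \<circ> S s)"
  shows "pos (w (sroot s))"
  using assms
proof (induction "len w" arbitrary: w s rule: less_induct)
  case less
  show ?case
  proof (cases "w = id")
    case True
    then show ?thesis by (simp add: pos_def sroot_def axis_def)
  next
    case False
    then obtain t where t: "len (w \<circ> S t) < len w" using exists_descent less.prems by blast
    with less.prems have "s \<noteq> t" by auto
    define P where "P k \<longleftrightarrow> (\<exists>v xs. v \<in> W \<and> set xs \<subseteq> {s, t} \<and> w = v \<circ> elem xs
      \<and> length xs = k \<and> len w = len v + k)" for k
    \<comment> \<open>Splitting off the descent \<open>t\<close> makes the maximal \<open>k\<close>
      at least 1, so that the factor \<open>v\<close> is shorter than \<open>w\<close> and the
      induction applies to it.\<close>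
    have "P 1"
      unfolding P_def using less.prems t len_le_comp_S[of w t]
      by (intro exI[of _ "w \<circ> S t"] exI[of _ "[t]"]) auto
    moreover have "k \<le> len w" if "P k" for k using that by (auto simp: P_def)
    ultimately obtain k where k: "P k" "\<And>j. P j \<Longrightarrow> j \<le> k"
      using Greatest_le_nat[of P _ "len w"] GreatestI_nat[of P 1 "len w"] by blast
    then have "k \<ge> 1" using \<open>P 1\<close> by auto
    obtain v xs where v: "v \<in> W" "set xs \<subseteq> {s, t}" "w = v \<circ> elem xs" "length xs = k"
      "len w = len v + k" using k(1) by (auto simp: P_def)
    \<comment> \<open>Otherwise \<open>a\<close> could be moved from \<open>v\<close> into the
      dihedral factor, against the maximality of \<open>k\<close>.\<close>
    have asc: "len v \<le> len (v \<circ> S a)" if a: "a \<in> {s, t}" for a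
    proof (rule ccontr)
      assume "\<not> ?thesis"
      then have lt: "len (v \<circ> S a) < len v" by simp
      have w: "w = (v \<circ> S a) \<circ> elem (a # xs)"
        using v by (simp add: fun_eq_iff)
      have "len w \<le> len (v \<circ> S a) + Suc k"
        using len_comp_elem[of "v \<circ> S a" "a # xs"] v w by simp
      with lt v have "len w = len (v \<circ> S a) + Suc k" by simp
      then have "P (Suc k)"
        unfolding P_def using a v w by (intro exI[of _ "v \<circ> S a"] exI[of _ "a # xs"]) auto
      then show False using k(2) by fastforce
    qed
    have "pos (v (sroot s))" "pos (v (sroot t))"
      using less.hyps[of v] asc v \<open>k \<ge> 1\<close> by auto
    have red: "k \<le> length ys" if "elem ys = elem xs" for ys
      using len_comp_elem[of v ys] v that by simp
    have red': "k \<le> length ys" if "elem ys = elem xs \<circ> S s" for ys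
      using len_comp_elem[of v ys] v that less.prems by (simp add: comp_assoc)
    have "xs = [] \<or> last xs = t"
    proof (rule ccontr)
      assume n: "\<not> ?thesis"
      moreover from this have "last xs \<in> {s, t}"
        using v(2) last_in_set[of xs] by (simp del: last_in_set) blast
      ultimately have "last xs = s" "xs \<noteq> []" by auto
      then obtain ys where ys: "xs = ys @ [s]" by (metis append_butlast_last_id)
      then have "elem ys = elem xs \<circ> S s" by simp
      from red'[OF this] show False using ys v(4) by simp
    qed
    with red v have alt: "xs = altw s t k"
      using reduced_dihedral_word[of xs s t] by auto
    \<comment> \<open>Otherwise \<open>xs\<close> ends in a full braid word, which can be rewritten
      to end in \<open>s\<close>; cancelling that letter yields a word for
      \<open>elem xs \<circ> S s\<close> that is too short for \<open>red'\<close>.\<close>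
    have "k < m s t"
    proof (rule ccontr)
      assume "\<not> ?thesis"
      then obtain j where j: "k = j + m s t" by (metis add.commute le_Suc_ex not_less)
      have split: "\<exists>ys. length ys = j \<and> altw a b (j + n) = ys @ altw a b n" for a b n j
      proof (induction n arbitrary: a b)
        case (Suc n)
        then show ?case by (metis Suc add_Suc_right altw.simps(2) append_assoc)
      qed simp
      obtain ys where ys: "length ys = j" "xs = ys @ altw s t (m s t)"
        using split[of j s t "m s t"] alt j by auto
      obtain M where M: "m s t = Suc M" using m_ge2[OF \<open>s \<noteq> t\<close>] by (cases "m s t") auto
      have "elem xs = elem ys \<circ> elem (altw s t M) \<circ> S s"
        using braid[OF \<open>s \<noteq> t\<close>] by (simp add: ys M comp_assoc del: altw.simps) (simp add: comp_assoc)
      then have "elem (ys @ altw s t M) = elem xs \<circ> S s" by simp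
      from red'[OF this] show False using ys j M by simp
    qed
    then obtain a b where ab: "a \<ge> 0" "b \<ge> 0" "elem xs (sroot s) = a *\<^sub>R sroot s + b *\<^sub>R sroot t"
      using altw_sroot_nonneg[OF \<open>s \<noteq> t\<close>] alt by metis
    then have "w (sroot s) = a *\<^sub>R v (sroot s) + b *\<^sub>R v (sroot t)"
      using v by (simp add: linear_add[OF linear_W] linear_scale[OF linear_W])
    then show ?thesis
      using \<open>pos (v (sroot s))\<close> \<open>pos (v (sroot t))\<close> ab by (simp add: pos_def)
  qed
qed

section \<open>Roots, and lengths read off from their signs\<close>

definition is_root :: "real^'i \<Rightarrow> bool" where
  "is_root b \<longleftrightarrow> (\<exists>w\<in>W. \<exists>s. b = w (sroot s))"

lemma root_sroot [simp]: "is_root (sroot s)"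
  unfolding is_root_def by (metis id_apply id_in_W)

lemma root_W: "is_root b \<Longrightarrow> w \<in> W \<Longrightarrow> is_root (w b)"
  unfolding is_root_def by (metis comp_apply comp_in_W)

lemma root_minus: "is_root b \<Longrightarrow> is_root (- b)"
  unfolding is_root_def by (metis S_in_W S_sroot W_minus comp_apply comp_in_W)

lemma B_root: "is_root b \<Longrightarrow> B b b = 1"
  by (auto simp: is_root_def B_W)

text \<open>\<open>pos_of_ascent\<close> applies to \<open>w\<close> or to
  \<open>w \<circ> S s\<close>, and these send \<open>sroot s\<close> to opposite vectors.\<close>

lemma pos_or_neg: "is_root b \<Longrightarrow> pos b \<or> pos (- b)"
proof -
  assume "is_root b"
  then obtain w s where w: "w \<in> W" "b = w (sroot s)" by (auto simp: is_root_def)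
  show ?thesis
    using pos_of_ascent[of w s] pos_of_ascent[of "w \<circ> S s" s] w
      nat_le_linear[of "len w" "len (w \<circ> S s)"] by (auto simp: S_sroot W_minus)
qed

lemma pos_minus: "is_root b \<Longrightarrow> pos (- b) \<longleftrightarrow> \<not> pos b"
proof -
  assume b: "is_root b"
  have "b = 0" if "pos b" "pos (- b)"
    using that by (auto simp: pos_def vec_eq_iff intro: antisym)
  then show ?thesis
    using b pos_or_neg[OF b] B_root[OF b] linear_0[OF linear_B] by fastforce
qed

lemma pos_sroot [simp]: "pos (sroot s)"
  by (simp add: pos_def sroot_def axis_def)

lemma len_comp_S_less_iff: "w \<in> W \<Longrightarrow> len w < len (w \<circ> S s) \<longleftrightarrow> pos (w (sroot s))"
  and len_comp_S_greater_iff: "w \<in> W \<Longrightarrow> len (w \<circ> S s) < len w \<longleftrightarrow> \<not> pos (w (sroot s))"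
proof -
  assume w: "w \<in> W"
  have r: "is_root (w (sroot s))" using w by (simp add: root_W)
  have "pos (w (sroot s))" if "len w \<le> len (w \<circ> S s)"
    using that w by (rule pos_of_ascent[rotated])
  moreover have "\<not> pos (w (sroot s))" if "len (w \<circ> S s) \<le> len w"
    using pos_of_ascent[of "w \<circ> S s" s] that w r by (simp add: S_sroot W_minus pos_minus)
  ultimately show "len w < len (w \<circ> S s) \<longleftrightarrow> pos (w (sroot s))"
    "len (w \<circ> S s) < len w \<longleftrightarrow> \<not> pos (w (sroot s))"
    by (meson leI less_imp_le linorder_neqE_nat)+
qed

lemma len_comp_S_cases:
  assumes "w \<in> W"
  obtains "pos (w (sroot s))" "len (w \<circ> S s) = Suc (len w)"
  | "\<not> pos (w (sroot s))" "Suc (len (w \<circ> S s)) = len w"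
proof (cases "pos (w (sroot s))")
  case True
  then have "len (w \<circ> S s) = Suc (len w)"
    using len_comp_S_less_iff[of w s] len_comp_S[of w s] assms by linarith
  with True that show ?thesis by blast
next
  case False
  then have "Suc (len (w \<circ> S s)) = len w"
    using len_comp_S_greater_iff[of w s] len_le_comp_S[of w s] assms by linarith
  with False that show ?thesis by blast
qed

text \<open>\<open>S s\<close> changes only the coordinate at \<open>s\<close>. A positive root
  supported there alone is \<open>sroot s\<close>, by its norm; any other keeps a positive
  coordinate, which decides its sign.\<close>

lemma pos_S:
  assumes "is_root b" "pos b" "b \<noteq> sroot s"
  shows "pos (S s b)"
proof -
  have "\<exists>j. j \<noteq> s \<and> b $ j \<noteq> 0"
  proof (rule ccontr)
    assume "\<not> ?thesis"
    then have b: "b = (b $ s) *\<^sub>R sroot s"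
      by (auto simp: vec_eq_iff sroot_def axis_def)
    have "1 = B ((b $ s) *\<^sub>R sroot s) ((b $ s) *\<^sub>R sroot s)"
      using B_root[OF assms(1)] b by simp
    then have "(b $ s)\<^sup>2 = 1" by (simp add: B_simps power2_eq_square)
    moreover have "b $ s \<ge> 0" using assms by (simp add: pos_def)
    ultimately have "b $ s = 1" by (simp add: power2_eq_1_iff)
    with b assms show False by simp
  qed
  then obtain j where j: "j \<noteq> s" "b $ j \<noteq> 0" by blast
  then have "(S s b) $ j > 0"
    using assms by (auto simp: pos_def sref_def sroot_def axis_def less_le)
  then have "\<not> pos (- S s b)" by (auto simp: pos_def not_le)
  then show ?thesis using pos_minus[of "S s b"] assms root_W by auto
qed

section \<open>Reflections in arbitrary roots and strong exchange\<close>

lemma refl_root: "w \<in> W \<Longrightarrow> reflect (w (sroot s)) = w \<circ> S s \<circ> inv w"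
  by (simp add: sref_eq_refl refl_conj comp_assoc)

lemma refl_in_W [simp]: "is_root b \<Longrightarrow> reflect b \<in> W"
  by (auto simp: is_root_def refl_root)

lemma refl_refl: "is_root b \<Longrightarrow> reflect b \<circ> (reflect b \<circ> w) = w"
  by (simp add: B_root refl_invol flip: comp_assoc)

lemma inv_refl: "is_root b \<Longrightarrow> inv (reflect b) = reflect b"
  by (simp add: B_root refl_invol inv_unique_comp)

lemma comp_refl_inv: "w \<in> W \<Longrightarrow> reflect b \<circ> w = w \<circ> reflect (inv w b)"
  by (simp add: refl_conj app_inv_W)

text \<open>Deleting the letter of a word at which the root
  \<open>b\<close> changes sign amounts to multiplying by the reflection in \<open>b\<close>.\<close>

lemma strong_exchange:
  assumes "is_root b" "pos b" "\<not> pos (elem (rev xs) b)"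
  shows "\<exists>ys. length ys < length xs \<and> elem ys = reflect b \<circ> elem xs"
  using assms
proof (induction xs arbitrary: b)
  case (Cons s xs)
  show ?case
  proof (cases "b = sroot s")
    case True
    then have "reflect b \<circ> elem (s # xs) = elem xs"
      by (simp add: sref_eq_refl refl_refl)
    then show ?thesis by (intro exI[of _ xs]) (simp only: length_Cons lessI simp_thms)
  next
    case False
    then obtain ys where ys: "length ys < length xs" "elem ys = reflect (S s b) \<circ> elem xs"
      using Cons.IH[of "S s b"] Cons.prems pos_S[of b s] root_W[of b "S s"] by force
    have "reflect b \<circ> elem (s # xs) = elem (s # ys)"
      using refl_conj[of "S s" "S s b"] by (simp add: ys(2) flip: comp_assoc)
    then show ?thesis using ys(1) by (metis Suc_less_eq length_Cons)
  qed
qed simp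

lemma len_refl_less:
  assumes "is_root b" "pos b" "w \<in> W" "\<not> pos (inv w b)"
  shows "len (reflect b \<circ> w) < len w"
proof -
  obtain xs where xs: "elem xs = w" "length xs = len w" using reduced_word assms by blast
  obtain ys where ys: "length ys < length xs" "elem ys = reflect b \<circ> w"
    using strong_exchange[of b xs] assms by (auto simp: inv_elem simp flip: xs(1))
  then show ?thesis using len_le[of ys] xs by simp
qed

lemma len_less_refl:
  assumes "is_root b" "pos b" "w \<in> W" "pos (inv w b)"
  shows "len w < len (reflect b \<circ> w)"
proof -
  have "inv (reflect b \<circ> w) b = - inv w b"
    using assms by (simp add: inv_comp inv_refl refl_self B_root W_minus)
  then have "\<not> pos (inv (reflect b \<circ> w) b)"
    using pos_minus[of "inv w b"] assms by (simp add: root_W)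
  then show ?thesis
    using len_refl_less[of b "reflect b \<circ> w"] assms by (simp add: refl_refl)
qed

lemma len_less_refl_iff:
  "is_root b \<Longrightarrow> pos b \<Longrightarrow> w \<in> W \<Longrightarrow> len w < len (reflect b \<circ> w) \<longleftrightarrow> pos (inv w b)"
  using len_less_refl len_refl_less by (metis less_asym)

subsection \<open>Bruhat order and the lifting property\<close>

abbreviation "le \<equiv> bruhat_le m"

text \<open>Left multiplication replaces the right multiplication of \<open>bruhat_step\<close>;
  conjugation translates (\<open>bruhat_step_iff\<close>). The positive root \<open>b\<close> then
  labels the edge, and on \<open>b\<close> linear functionals can be evaluated.\<close>

definition up :: "(real^'i \<Rightarrow> real^'i) \<Rightarrow> (real^'i \<Rightarrow> real^'i) \<Rightarrow> bool" where
  "up x y \<longleftrightarrow> x \<in> W \<and> (\<exists>b. is_root b \<and> pos b \<and> y = reflect b \<circ> x \<and> len x < len y)"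

lemma crefl_eq: "crefl m = {reflect b | b. is_root b}"
proof -
  have "elem xs \<circ> S s \<circ> elem (rev xs) = reflect (elem xs (sroot s))" for xs s
    by (simp add: refl_root inv_elem)
  moreover have "is_root b \<longleftrightarrow> (\<exists>xs s. b = elem xs (sroot s))" for b
    by (auto simp: is_root_def coxW_def)
  ultimately show ?thesis unfolding crefl_def by auto
qed

lemma root_pos_rep:
  assumes "is_root b" obtains c where "is_root c" "pos c" "reflect c = reflect b"
proof (cases "pos b")
  case False
  then show ?thesis using that[of "- b"] assms root_minus pos_minus[of b] by simp
qed (use assms that in blast)

lemma bruhat_step_iff: "(x, y) \<in> bruhat_step m \<longleftrightarrow> up x y"
proof
  assume "(x, y) \<in> bruhat_step m"
  then obtain b where b: "x \<in> W" "is_root b" "y = x \<circ> reflect b" "len x < len y"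
    by (auto simp: bruhat_step_def crefl_eq)
  then obtain c where "is_root c" "pos c" "reflect c = reflect (x b)"
    using root_pos_rep[of "x b"] root_W by metis
  then show "up x y" using b by (auto simp: up_def refl_conj)
next
  assume "up x y"
  then obtain b where b: "x \<in> W" "is_root b" "y = reflect b \<circ> x" "len x < len y"
    by (auto simp: up_def)
  then have "y = x \<circ> reflect (inv x b)" "is_root (inv x b)"
    by (simp_all add: comp_refl_inv root_W)
  with b show "(x, y) \<in> bruhat_step m"
    by (simp add: bruhat_step_def crefl_eq) metis
qed

lemma up_in_W: "up x y \<Longrightarrow> x \<in> W \<and> y \<in> W"
  by (auto simp: up_def)

lemma le_in_W: "le x y \<Longrightarrow> x \<in> W \<and> y \<in> W"
proof -
  assume "le x y"
  then have "x \<in> W" "(x, y) \<in> (bruhat_step m)\<^sup>*" by (auto simp: bruhat_le_def)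
  from this(2,1) show ?thesis
    by (induction rule: rtrancl_induct) (auto simp: bruhat_step_iff dest: up_in_W)
qed

lemma le_refl: "x \<in> W \<Longrightarrow> le x x"
  by (simp add: bruhat_le_def)

lemma le_trans [trans]: "le x y \<Longrightarrow> le y z \<Longrightarrow> le x z"
  by (auto simp: bruhat_le_def)

lemma up_le: "up x y \<Longrightarrow> le x y"
  by (auto simp: bruhat_le_def bruhat_step_iff dest: up_in_W)

lemma le_induct [consumes 1, case_names refl step]:
  assumes "le x y" "P x" "\<And>y z. le x y \<Longrightarrow> up y z \<Longrightarrow> P y \<Longrightarrow> P z"
  shows "P y"
proof -
  have x: "x \<in> W" "(x, y) \<in> (bruhat_step m)\<^sup>*" using assms(1) by (auto simp: bruhat_le_def)
  from x(2) show ?thesis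
    by (induction rule: rtrancl_induct)
      (use x(1) assms in \<open>auto simp: bruhat_step_iff bruhat_le_def\<close>)
qed

lemma le_len: "le x y \<Longrightarrow> x = y \<or> len x < len y"
  by (induction rule: le_induct) (auto simp: up_def)

text \<open>\<open>lo\<close> and \<open>hi\<close> pick the shorter and the longer element of the
  coset of \<open>x\<close> modulo \<open>S s\<close>. The lifting property is used in the form that
  both are monotone (\<open>le_lo\<close>, \<open>le_hi\<close>).\<close>

definition lo :: "'i \<Rightarrow> (real^'i \<Rightarrow> real^'i) \<Rightarrow> real^'i \<Rightarrow> real^'i" where
  "lo s x = (if pos (x (sroot s)) then x else x \<circ> S s)"

definition hi :: "'i \<Rightarrow> (real^'i \<Rightarrow> real^'i) \<Rightarrow> real^'i \<Rightarrow> real^'i" where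
  "hi s x = (if pos (x (sroot s)) then x \<circ> S s else x)"

lemma up_S: "x \<in> W \<Longrightarrow> pos (x (sroot s)) \<Longrightarrow> up x (x \<circ> S s)"
  unfolding up_def using len_comp_S_less_iff[of x s]
  by (intro conjI exI[of _ "x (sroot s)"]) (simp_all add: root_W refl_root comp_assoc)

lemma up_S': "x \<in> W \<Longrightarrow> \<not> pos (x (sroot s)) \<Longrightarrow> up (x \<circ> S s) x"
  using up_S[of "x \<circ> S s" s] pos_minus[of "x (sroot s)"] by (simp add: S_sroot W_minus root_W)

lemma le_S: "x \<in> W \<Longrightarrow> pos (x (sroot s)) \<Longrightarrow> le x (x \<circ> S s)"
  and le_S': "x \<in> W \<Longrightarrow> \<not> pos (x (sroot s)) \<Longrightarrow> le (x \<circ> S s) x"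
  by (auto intro: up_le up_S up_S')

text \<open>The only positive root that \<open>S s\<close> makes negative is \<open>sroot s\<close>,
  so every edge not in direction \<open>s\<close> survives right multiplication by
  \<open>S s\<close>.\<close>

lemma up_comp_S:
  assumes "up x y" shows "y = x \<circ> S s \<or> up (x \<circ> S s) (y \<circ> S s)"
proof -
  obtain b where b: "x \<in> W" "is_root b" "pos b" "y = reflect b \<circ> x" "len x < len y"
    using assms by (auto simp: up_def)
  then have p: "pos (inv x b)" using len_less_refl_iff[of b x] by simp
  show ?thesis
  proof (cases "inv x b = sroot s")
    case True
    then show ?thesis using b by (simp add: comp_refl_inv sref_eq_refl)
  next
    case False
    then have "pos (S s (inv x b))" using pos_S p b by (simp add: root_W)
    then have "len (x \<circ> S s) < len (reflect b \<circ> (x \<circ> S s))"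
      using b by (subst len_less_refl_iff) (simp_all add: inv_comp)
    then show ?thesis using b by (auto simp: up_def comp_assoc)
  qed
qed

lemma pos_comp_S: "x \<in> W \<Longrightarrow> pos ((x \<circ> S s) (sroot s)) \<longleftrightarrow> \<not> pos (x (sroot s))"
  by (simp add: S_sroot W_minus pos_minus root_W)

text \<open>Either the edge lies inside one coset, or it has a parallel edge; then the two parallel
  edges and the edges within the cosets give all comparisons.\<close>

lemma up_lo_hi: assumes "up x y" shows "le (lo s x) (lo s y) \<and> le (hi s x) (hi s y)"
proof -
  have W: "x \<in> W" "y \<in> W" using up_in_W[OF assms] by auto
  consider "y = x \<circ> S s" | "up (x \<circ> S s) (y \<circ> S s)" using up_comp_S[OF assms] by blast
  then show ?thesis
  proof cases
    case 1
    then have "lo s y = lo s x" "hi s y = hi s x"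
      using pos_comp_S[OF W(1)] by (simp_all add: lo_def hi_def)
    then show ?thesis using W by (simp add: lo_def hi_def le_refl)
  next
    case 2
    have "le x y" "le (x \<circ> S s) (y \<circ> S s)" using assms 2 by (auto intro: up_le)
    then show ?thesis
      using le_S[OF W(1), of s] le_S[OF W(2), of s] le_S'[OF W(1), of s] le_S'[OF W(2), of s]
      by (auto simp: lo_def hi_def intro: le_trans)
  qed
qed

lemma le_lo: "le x y \<Longrightarrow> le (lo s x) (lo s y)"
  and le_hi: "le x y \<Longrightarrow> le (hi s x) (hi s y)"
proof -
  assume xy: "le x y"
  then have "x \<in> W" by (simp add: le_in_W)
  with xy have "le (lo s x) (lo s y) \<and> le (hi s x) (hi s y)"
  proof (induction rule: le_induct)
    case refl
    then show ?case by (simp add: lo_def hi_def le_refl)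
  next
    case (step y z)
    then show ?case using up_lo_hi le_trans by blast
  qed
  then show "le (lo s x) (lo s y)" "le (hi s x) (hi s y)" by auto
qed

subsection \<open>Hecke operators on functions on the group\<close>

text \<open>Left and right multiplication by \<open>T\<^sub>s\<close> in the Hecke algebra with
  \<open>T\<^sub>s - T\<^sub>s\<inverse> = q\<close>, in coordinates with respect to the basis
  \<open>(T\<^sub>w\<^sub>\<inverse>)\<inverse>\<close>; \<open>pCons 0\<close> is multiplication by \<open>q\<close>.\<close>

definition tau :: "'i \<Rightarrow> ((real^'i \<Rightarrow> real^'i) \<Rightarrow> nat poly) \<Rightarrow> (real^'i \<Rightarrow> real^'i) \<Rightarrow> nat poly" where
  "tau s f y = f (S s \<circ> y) + (if pos (inv y (sroot s)) then pCons 0 (f y) else 0)"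

definition sig :: "'i \<Rightarrow> ((real^'i \<Rightarrow> real^'i) \<Rightarrow> nat poly) \<Rightarrow> (real^'i \<Rightarrow> real^'i) \<Rightarrow> nat poly" where
  "sig s f y = f (y \<circ> S s) + (if pos (y (sroot s)) then pCons 0 (f y) else 0)"

definition delta :: "(real^'i \<Rightarrow> real^'i) \<Rightarrow> (real^'i \<Rightarrow> real^'i) \<Rightarrow> nat poly" where
  "delta v y = (if y = v then 1 else 0)"

lemma pos_S_iff:
  assumes "is_root b" "b \<noteq> sroot s" "b \<noteq> - sroot s"
  shows "pos (S s b) \<longleftrightarrow> pos b"
proof -
  have "pos (S s (- b))" if "\<not> pos b"
    using that assms pos_S[of "- b" s] root_minus[of b] pos_minus[of b] by (metis minus_minus)
  then show ?thesis
    using pos_S[of b s] assms pos_minus[of "S s b"] root_W[of b "S s"]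
    by (auto simp: linear_neg[OF linear_S])
qed

lemma S_comp_eq: "y \<in> W \<Longrightarrow> y (sroot t) = sroot s \<or> y (sroot t) = - sroot s \<Longrightarrow> S s \<circ> y = y \<circ> S t"
  using refl_conj[of y "sroot t"] by (auto simp: sref_eq_refl)

lemma pCons_0_add: "pCons 0 (f + g) = pCons 0 f + pCons (0::nat) g"
  by simp

text \<open>The sign conditions of the two operators interact only if \<open>y (sroot t)\<close> is
  plus or minus \<open>sroot s\<close>. In that case \<open>S s \<circ> y = y \<circ> S t\<close>,
  and both operators act at \<open>y\<close> in the same way.\<close>

lemma tau_sig:
  assumes y: "y \<in> W"
  shows "tau s (sig t f) y = sig t (tau s f) y"
proof (cases "y (sroot t) = sroot s \<or> y (sroot t) = - sroot s")
  case True
  then have sy: "S s \<circ> y = y \<circ> S t" using S_comp_eq y by blast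
  have "inv y (sroot s) = sroot t" if "y (sroot t) = sroot s"
    using inv_app_W[OF y, of "sroot t"] that by simp
  moreover have "inv y (sroot s) = - sroot t" if "y (sroot t) = - sroot s"
    using inv_app_W[OF y, of "sroot t"] that y by (simp add: W_minus minus_equation_iff)
  moreover have "\<not> pos (- sroot a)" for a by (simp add: pos_minus)
  ultimately have "pos (inv y (sroot s)) \<longleftrightarrow> pos (y (sroot t))"
    using True by auto
  moreover have "pos ((S s \<circ> y) (sroot t)) \<longleftrightarrow> \<not> pos (y (sroot t))"
    unfolding sy using pos_comp_S[OF y] by simp
  moreover have "inv (y \<circ> S t) (sroot s) = - inv y (sroot s)"
    unfolding sy[symmetric] using y by (simp add: inv_comp S_sroot W_minus)
  then have "pos (inv (y \<circ> S t) (sroot s)) \<longleftrightarrow> \<not> pos (inv y (sroot s))"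
    using y pos_minus[of "inv y (sroot s)"] by (simp add: root_W)
  moreover have "S s \<circ> (y \<circ> S t) = S s \<circ> y \<circ> S t" by (simp add: comp_assoc)
  ultimately show ?thesis
    unfolding tau_def sig_def sy by simp
next
  case False
  then have "inv y (sroot s) \<noteq> sroot t" "inv y (sroot s) \<noteq> - sroot t"
    using app_inv_W[OF y, of "sroot s"] W_minus[OF y, of "sroot t"]
    by (auto simp: minus_equation_iff[of "y (sroot t)"])
  then have "pos (inv (y \<circ> S t) (sroot s)) \<longleftrightarrow> pos (inv y (sroot s))"
    using y pos_S_iff[of "inv y (sroot s)" t] by (simp add: inv_comp root_W)
  moreover have "pos ((S s \<circ> y) (sroot t)) \<longleftrightarrow> pos (y (sroot t))"
    using False y pos_S_iff[of "y (sroot t)" s] by (simp add: root_W)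
  moreover have "S s \<circ> (y \<circ> S t) = S s \<circ> y \<circ> S t" by (simp add: comp_assoc)
  ultimately show ?thesis
    unfolding tau_def sig_def by (simp add: pCons_0_add add_ac del: add_pCons)
qed

lemma tau_cong:
  "(\<And>y. y \<in> W \<Longrightarrow> f y = g y) \<Longrightarrow> y \<in> W \<Longrightarrow> tau s f y = tau s g y"
  by (simp add: tau_def)

lemma foldr_tau_cong:
  assumes "\<And>y. y \<in> W \<Longrightarrow> f y = g y" "y \<in> W"
  shows "foldr tau xs f y = foldr tau xs g y"
  using assms(2)
proof (induction xs arbitrary: y)
  case (Cons s xs)
  then show ?case unfolding foldr_Cons comp_apply by (intro tau_cong)
qed (simp add: assms(1))

lemma foldr_tau_sig:
  "y \<in> W \<Longrightarrow> foldr tau xs (sig t f) y = sig t (foldr tau xs f) y"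
proof (induction xs arbitrary: y)
  case (Cons s xs)
  have "foldr tau (s # xs) (sig t f) y = tau s (sig t (foldr tau xs f)) y"
    unfolding foldr_Cons comp_apply using Cons by (intro tau_cong)
  also have "\<dots> = sig t (foldr tau (s # xs) f) y"
    using Cons.prems by (simp add: tau_sig)
  finally show ?case .
qed simp

section \<open>R-polynomials along a word\<close>

lemma sig_delta:
  assumes "\<not> pos (v (sroot s))"
  shows "sig s (delta v) y = delta (v \<circ> S s) y"
proof -
  have "y \<circ> S s = v \<longleftrightarrow> y = v \<circ> S s" by (metis comp_S_S)
  with assms show ?thesis by (auto simp: sig_def delta_def)
qed

lemma tau_delta:
  assumes "y \<in> W" "v \<in> W" "\<not> pos (inv v (sroot s))"
  shows "tau s (delta v) y = delta (S s \<circ> v) y"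
proof -
  have "S s \<circ> y = v \<longleftrightarrow> y = S s \<circ> v"
    by (metis S_invol comp_assoc id_comp)
  with assms show ?thesis by (auto simp: tau_def delta_def)
qed

text \<open>For \<open>w = id\<close> and a reduced word this is the inversion sequence; a reduced
  word of the longest element thus lists the positive roots in a reflection order.\<close>

fun word_roots :: "(real^'i \<Rightarrow> real^'i) \<Rightarrow> 'i list \<Rightarrow> (real^'i) list" where
  "word_roots w [] = []"
| "word_roots w (s # xs) = w (sroot s) # word_roots (w \<circ> S s) xs"

lemma rts_append: "word_roots w (xs @ ys) = word_roots w xs @ word_roots (w \<circ> elem xs) ys"
  by (induction xs arbitrary: w) (simp_all add: comp_assoc)

lemma root_rts: "w \<in> W \<Longrightarrow> b \<in> set (word_roots w xs) \<Longrightarrow> is_root b"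
proof (induction xs arbitrary: w)
  case (Cons s xs)
  then show ?case using Cons.IH[of "w \<circ> S s"] by (auto simp: root_W simp del: comp_apply)
qed simp

text \<open>At the root \<open>b\<close> a path either stays at \<open>x\<close> or takes the upward
  edge labelled \<open>b\<close>, with weight q. Folding over a list of roots sums over the paths
  whose labels increase along it.\<close>

definition reflect_op :: "real^'i \<Rightarrow> ((real^'i \<Rightarrow> real^'i) \<Rightarrow> nat poly) \<Rightarrow> (real^'i \<Rightarrow> real^'i) \<Rightarrow> nat poly" where
  "reflect_op b f x = f x + (if pos (inv x b) then pCons 0 (f (reflect b \<circ> x)) else 0)"

text \<open>In coordinates translated by \<open>w \<circ> S s\<close>, the first summand of
  \<open>tau s\<close> becomes the choice to stay and its q-term the edge labelled
  \<open>w (sroot s)\<close>.\<close>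

lemma foldr_est_tau:
  assumes "w \<in> W" "y \<in> W"
  shows "foldr reflect_op (word_roots w xs) f (w \<circ> y) = foldr tau xs (\<lambda>z. f (w \<circ> elem xs \<circ> z)) y"
  using assms
proof (induction xs arbitrary: w y)
  case (Cons s xs)
  define F where "F = foldr reflect_op (word_roots (w \<circ> S s) xs) f"
  define g where "g = foldr tau xs (\<lambda>z. f (w \<circ> S s \<circ> elem xs \<circ> z))"
  have Fg: "F (w \<circ> S s \<circ> z) = g z" if "z \<in> W" for z
    unfolding F_def g_def by (rule Cons.IH) (simp_all add: Cons.prems that del: comp_apply)
  have 1: "w \<circ> y = w \<circ> S s \<circ> (S s \<circ> y)" by (simp add: fun_eq_iff)
  have 2: "reflect (w (sroot s)) \<circ> (w \<circ> y) = w \<circ> S s \<circ> y"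
    using Cons.prems by (simp add: refl_root fun_eq_iff inv_app_W)
  have 3: "inv (w \<circ> y) (w (sroot s)) = inv y (sroot s)"
    using Cons.prems by (simp add: inv_comp inv_app_W)
  have "foldr reflect_op (word_roots w (s # xs)) f (w \<circ> y) = reflect_op (w (sroot s)) F (w \<circ> y)"
    by (simp add: F_def)
  also have "\<dots> = F (w \<circ> y) + (if pos (inv y (sroot s)) then pCons 0 (F (w \<circ> S s \<circ> y)) else 0)"
    unfolding reflect_op_def 2 3 ..
  also have "\<dots> = tau s g y"
    unfolding tau_def using Fg[of y] Fg[of "S s \<circ> y"] Cons.prems 1 by simp
  finally show "foldr reflect_op (word_roots w (s # xs)) f (w \<circ> y)
      = foldr tau (s # xs) (\<lambda>z. f (w \<circ> elem (s # xs) \<circ> z)) y"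
    by (simp add: g_def comp_assoc)
qed simp

text \<open>Negativity on simple roots passes to all positive roots, which are nonnegative
  combinations of them (\<open>longest_neg\<close>).\<close>

definition longest :: "(real^'i \<Rightarrow> real^'i) \<Rightarrow> bool" where
  "longest w \<longleftrightarrow> w \<in> W \<and> (\<forall>s. \<not> pos (w (sroot s)))"

lemma linear_sroot_sum: "linear f \<Longrightarrow> f b = (\<Sum>a\<in>UNIV. (b $ a) *\<^sub>R f (sroot a))"
  by (subst sum_sroot) (simp add: linear_sum linear_scale)

lemma longest_neg:
  assumes "longest w" "is_root b" "pos b"
  shows "\<not> pos (w b)"
proof -
  have w: "w \<in> W" using assms by (simp add: longest_def)
  have "pos (- w (sroot a))" for a
    using assms pos_minus[of "w (sroot a)"] w by (simp add: longest_def root_W)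
  then have "w (sroot a) $ i \<le> 0" for a i by (simp add: pos_def)
  then have "w b $ i \<le> 0" for i
    unfolding linear_sroot_sum[OF linear_W[OF w], of b] sum_component
    using assms by (intro sum_nonpos) (simp add: pos_def mult_nonneg_nonpos)
  then have "pos (- w b)" by (simp add: pos_def)
  then show ?thesis using pos_minus[of "w b"] assms w by (simp add: root_W)
qed

lemma longest_inv_neg: "longest w \<Longrightarrow> is_root b \<Longrightarrow> pos b \<Longrightarrow> \<not> pos (inv w b)"
  using longest_neg[of w "inv w b"] by (auto simp: longest_def root_W app_inv_W)

text \<open>The entry of \<open>T\<^sub>v\<close> at \<open>u\<close> with respect to the dual standard basis of the Hecke algebra,
  i.e. the \<open>R\<close>-polynomial, computed along the reflection order given by the word \<open>xs\<close>.\<close>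

definition rpoly :: "'i list \<Rightarrow> (real^'i \<Rightarrow> real^'i) \<Rightarrow> (real^'i \<Rightarrow> real^'i) \<Rightarrow> nat poly" where
  "rpoly xs v u = foldr reflect_op (word_roots id xs) (delta v) u"

lemma rpoly_tau:
  assumes "u \<in> W"
  shows "rpoly xs v u = foldr tau xs (delta (elem (rev xs) \<circ> v)) u"
proof -
  have "rpoly xs v u = foldr tau xs (\<lambda>z. delta v (elem xs \<circ> z)) u"
    using foldr_est_tau[of id u xs "delta v"] assms by (simp add: rpoly_def)
  also have "\<dots> = foldr tau xs (delta (elem (rev xs) \<circ> v)) u"
  proof (rule foldr_tau_cong[OF _ assms])
    fix y
    have "elem xs \<circ> y = v \<longleftrightarrow> y = elem (rev xs) \<circ> v"
      by (metis comp_assoc elem_rev id_comp)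
    then show "delta v (elem xs \<circ> y) = delta (elem (rev xs) \<circ> v) y"
      by (simp add: delta_def)
  qed
  finally show ?thesis .
qed

text \<open>Positivity of the listed roots makes every letter, read from the right, a left descent
  of what remains of the inverse word, so \<open>tau_delta\<close> strips it.\<close>

lemma rpoly_id:
  assumes "\<forall>b\<in>set (word_roots id xs). pos b" "u \<in> W"
  shows "rpoly xs id u = delta id u"
proof -
  have "foldr tau xs (delta (elem (rev xs))) u = delta id u"
    using assms
  proof (induction xs arbitrary: u rule: rev_induct)
    case (snoc s ys)
    have p: "pos (elem ys (sroot s))" "\<forall>b\<in>set (word_roots id ys). pos b"
      using snoc.prems unfolding rts_append by auto
    have "inv (S s \<circ> elem (rev ys)) (sroot s) = - elem ys (sroot s)"
      by (simp add: inv_comp inv_elem S_sroot W_minus)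
    then have n: "\<not> pos (inv (S s \<circ> elem (rev ys)) (sroot s))"
      using p pos_minus[of "elem ys (sroot s)"] by (simp add: root_W)
    have "foldr tau (ys @ [s]) (delta (elem (rev (ys @ [s])))) u
        = foldr tau ys (tau s (delta (S s \<circ> elem (rev ys)))) u" by simp
    also have "\<dots> = foldr tau ys (delta (elem (rev ys))) u"
    proof (rule foldr_tau_cong[OF _ snoc.prems(2)])
      fix y assume "y \<in> W"
      then have "tau s (delta (S s \<circ> elem (rev ys))) y = delta (S s \<circ> (S s \<circ> elem (rev ys))) y"
        using n by (intro tau_delta) simp_all
      then show "tau s (delta (S s \<circ> elem (rev ys))) y = delta (elem (rev ys)) y"
        by (simp flip: comp_assoc)
    qed
    also have "\<dots> = delta id u" using snoc.IH p snoc.prems by blast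
    finally show ?case .
  qed simp
  then show ?thesis using rpoly_tau[OF assms(2)] by simp
qed

text \<open>This is the right recursion of the R-polynomials. Multiplication by the inverse of the
  longest element turns the ascent \<open>s\<close> of \<open>v\<close> into a descent, where
  \<open>sig\<close> maps basis vectors to basis vectors, and \<open>sig\<close> commutes past all
  \<open>tau\<close>.\<close>

lemma rpoly_comp_S:
  assumes "longest (elem xs)" "v \<in> W" "pos (v (sroot s))" "u \<in> W"
  shows "rpoly xs (v \<circ> S s) u = sig s (rpoly xs v) u"
proof -
  let ?v = "elem (rev xs) \<circ> v"
  have n: "\<not> pos (?v (sroot s))"
    using longest_inv_neg[OF assms(1), of "v (sroot s)"] assms by (simp add: inv_elem root_W)
  have "rpoly xs (v \<circ> S s) u = foldr tau xs (delta (?v \<circ> S s)) u"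
    using assms by (simp add: rpoly_tau comp_assoc)
  also have "\<dots> = foldr tau xs (sig s (delta ?v)) u"
    using assms n by (intro foldr_tau_cong) (simp_all add: sig_delta)
  also have "\<dots> = sig s (foldr tau xs (delta ?v)) u"
    using assms by (simp add: foldr_tau_sig)
  also have "\<dots> = sig s (rpoly xs v) u"
    using assms by (simp add: sig_def rpoly_tau)
  finally show ?thesis .
qed

text \<open>Since \<open>n\<close> runs over everything from \<open>len v - len u\<close> on, the
  degree bound and the leading coefficient are proved together. The induction strips a right descent
  off the upper element; \<open>le_lo\<close> and \<open>le_hi\<close> translate the Bruhat
  conditions.\<close>

lemma rpoly_top_coeff:
  assumes xs: "\<forall>b\<in>set (word_roots id xs). pos b" "longest (elem xs)"
    and "v \<in> W" "u \<in> W" "len v \<le> n + len u"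
  shows "coeff (rpoly xs v u) n = (if le u v \<and> n + len u = len v then 1 else 0)"
  using assms(3-5)
proof (induction "len v" arbitrary: v u n)
  case 0
  then have v: "v = id" using len_0 by simp
  have "le u id \<longleftrightarrow> u = id"
    using le_len[of u id] le_refl[OF id_in_W] by auto
  then show ?case
    unfolding v rpoly_id[OF xs(1) \<open>u \<in> W\<close>] using len_0[OF \<open>u \<in> W\<close>]
    by (auto simp: delta_def coeff_1 simp del: id_apply)
next
  case (Suc k v')
  from Suc have "v' \<noteq> id" by auto
  then obtain s where "len (v' \<circ> S s) < len v'" using exists_descent Suc.prems by blast
  then have v's: "\<not> pos (v' (sroot s))" using len_comp_S_greater_iff Suc.prems by blast
  define v where "v = v' \<circ> S s"
  have v: "v \<in> W" "v' = v \<circ> S s" "pos (v (sroot s))"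
    using Suc.prems v's pos_comp_S[of v' s] by (simp_all add: v_def)
  then have lenv': "len v' = Suc (len v)" by (auto elim: len_comp_S_cases[of v s])
  then have k: "k = len v" using Suc.hyps by simp
  have lo: "lo s v' = v" "hi s v' = v'" "lo s v = v" "hi s v = v'"
    by (simp_all only: lo_def hi_def v's v(3) if_True if_False v_def[symmetric] v(2)[symmetric])
  have eq: "rpoly xs v' u = rpoly xs v (u \<circ> S s) + (if pos (u (sroot s)) then pCons 0 (rpoly xs v u) else 0)"
    using rpoly_comp_S[OF xs(2) v(1) v(3)] Suc.prems v by (simp add: sig_def)
  have vv': "le v v'" using v by (simp add: le_S)
  from \<open>u \<in> W\<close> show ?case
  proof (cases rule: len_comp_S_cases[of u s])
    case 1
    then have los: "lo s u = u" by (simp add: lo_def)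
    have "le u v' \<longleftrightarrow> le u v"
      using le_lo[of u v' s] le_trans[OF _ vv'] unfolding lo los by blast
    \<comment> \<open>The lower element went up and the upper one down, so \<open>n\<close> exceeds
      the degree bound by at least 2.\<close>
    moreover have "coeff (rpoly xs v (u \<circ> S s)) n = 0"
      using Suc.hyps(1)[OF k v(1), of "u \<circ> S s" n] Suc.prems 1 lenv' by simp
    moreover have "coeff (pCons 0 (rpoly xs v u)) n = (if le u v \<and> n + len u = len v' then 1 else 0)"
    proof (cases "n = 0")
      case True
      then show ?thesis using Suc.prems lenv' le_len[of u v] by auto
    next
      case False
      then obtain n' where "n = Suc n'" by (metis not0_implies_Suc)
      then show ?thesis
        using Suc.hyps(1)[OF k v(1), of u n'] Suc.prems lenv' by simp
    qed
    ultimately show ?thesis using eq 1 by simp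
  next
    case 2
    then have los: "lo s u = u \<circ> S s" by (simp add: lo_def)
    have los': "hi s (u \<circ> S s) = u"
      using pos_comp_S[OF \<open>u \<in> W\<close>, of s] 2 unfolding hi_def by simp
    have "le u v' \<longleftrightarrow> le (u \<circ> S s) v"
      using le_lo[of u v' s] le_hi[of "u \<circ> S s" v s] unfolding lo los los' by blast
    then show ?thesis
      using Suc.hyps(1)[OF k v(1), of "u \<circ> S s" n] eq Suc.prems lenv' 2 by auto
  qed
qed

subsection \<open>Saturated chains increasing for a reflection order\<close>

text \<open>Counts the saturated chains from \<open>u\<close> to \<open>v\<close> whose labels form
  a subsequence of the list, hence increase in its order.\<close>

fun chains :: "(real^'i) list \<Rightarrow> (real^'i \<Rightarrow> real^'i) \<Rightarrow> (real^'i \<Rightarrow> real^'i) \<Rightarrow> nat" where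
  "chains [] u v = (if u = v then 1 else 0)"
| "chains (b # bs) u v = chains bs u v
     + (if len (reflect b \<circ> u) = Suc (len u) then chains bs (reflect b \<circ> u) v else 0)"

lemma chains_len: "chains bs u v \<noteq> 0 \<Longrightarrow> len u \<le> len v"
proof (induction bs arbitrary: u)
  case (Cons b bs)
  then consider "chains bs u v \<noteq> 0"
    | "len (reflect b \<circ> u) = Suc (len u)" "chains bs (reflect b \<circ> u) v \<noteq> 0"
    by (auto simp del: comp_apply split: if_splits)
  then show ?case by cases (use Cons.IH in fastforce)+
qed (simp split: if_splits)

text \<open>The exponent of q counts the steps of a path, and each step raises the length; a path
  with \<open>len v - len u\<close> steps is therefore saturated.\<close>

lemma coeff_foldr_est:
  assumes "\<And>b. b \<in> set bs \<Longrightarrow> is_root b \<and> pos b" "u \<in> W" "len v \<le> n + len u"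
  shows "coeff (foldr reflect_op bs (delta v) u) n = (if n + len u = len v then chains bs u v else 0)"
  using assms
proof (induction bs arbitrary: u n)
  case (Cons b bs)
  have b: "is_root b" "pos b" using Cons.prems by auto
  have IH: "coeff (foldr reflect_op bs (delta v) x) k = (if k + len x = len v then chains bs x v else 0)"
    if "x \<in> W" "len v \<le> k + len x" for x k
    using Cons.IH[of x k] Cons.prems that by auto
  have "coeff (if pos (inv u b) then pCons 0 (foldr reflect_op bs (delta v) (reflect b \<circ> u)) else 0) n
    = (if len (reflect b \<circ> u) = Suc (len u) \<and> n + len u = len v then chains bs (reflect b \<circ> u) v else 0)"
  proof (cases "pos (inv u b)")
    case True
    then have l: "len u < len (reflect b \<circ> u)" using len_less_refl b Cons.prems by blast
    show ?thesis
    proof (cases n)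
      case 0
      then have "chains bs (reflect b \<circ> u) v = 0"
        using chains_len[of bs "reflect b \<circ> u" v] l Cons.prems by linarith
      with 0 True show ?thesis by simp
    next
      case (Suc k)
      then show ?thesis
        using IH[of "reflect b \<circ> u" k] l Cons.prems b True by auto
    qed
  next
    case False
    then have "len (reflect b \<circ> u) \<noteq> Suc (len u)"
      using len_refl_less[of b u] b Cons.prems by auto
    with False show ?thesis by simp
  qed
  moreover have "u \<in> W" "len v \<le> n + len u" using Cons.prems by auto
  ultimately show "coeff (foldr reflect_op (b # bs) (delta v) u) n
      = (if n + len u = len v then chains (b # bs) u v else 0)"
    using IH[of u n] by (simp add: reflect_op_def)
qed (auto simp: delta_def)

text \<open>The leading coefficient of \<open>rpoly\<close> is computed in two ways: as a number of
  chains and by the Hecke recursion.\<close>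

theorem chains_eq:
  assumes "\<forall>b\<in>set (word_roots id xs). pos b" "longest (elem xs)" "u \<in> W" "v \<in> W"
  shows "le u v \<Longrightarrow> chains (word_roots id xs) u v = 1"
proof -
  assume le: "le u v"
  then have l: "len u \<le> len v" using le_len by fastforce
  have "is_root b \<and> pos b" if "b \<in> set (word_roots id xs)" for b
    using assms(1) that root_rts[OF id_in_W] by blast
  then have "coeff (rpoly xs v u) (len v - len u) = chains (word_roots id xs) u v"
    using coeff_foldr_est[of "word_roots id xs" u v "len v - len u"] assms l by (simp add: rpoly_def)
  then show ?thesis using rpoly_top_coeff[of xs v u "len v - len u"] assms le l by simp
qed

text \<open>Every chain is cut at the element where its labels pass from \<open>as\<close> to
  \<open>bs\<close>.\<close>

lemma sum_chains:
  assumes "finite W" "u \<in> W" "\<And>b. b \<in> set as \<Longrightarrow> is_root b"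
  shows "chains (as @ bs) u v = (\<Sum>z\<in>W. chains as u z * chains bs z v)"
  using assms(2,3)
proof (induction as arbitrary: u)
  case Nil
  have "(\<Sum>z\<in>W. chains [] u z * chains bs z v) = (\<Sum>z\<in>W. if z = u then chains bs z v else 0)"
    by (intro sum.cong) auto
  also have "\<dots> = chains bs u v" using Nil assms(1) by simp
  finally show ?case by simp
next
  case (Cons b as)
  have IH: "chains (as @ bs) x v = (\<Sum>z\<in>W. chains as x z * chains bs z v)" if "x \<in> W" for x
    using Cons that by simp
  have "u \<in> W" "reflect b \<circ> u \<in> W" using Cons.prems by (simp_all del: comp_apply)
  then show "chains ((b # as) @ bs) u v = (\<Sum>z\<in>W. chains (b # as) u z * chains bs z v)"
    by (simp add: IH add_mult_distrib sum.distrib)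
qed

definition covered :: "(real^'i) set \<Rightarrow> (real^'i \<Rightarrow> real^'i) \<Rightarrow> (real^'i \<Rightarrow> real^'i) \<Rightarrow> bool" where
  "covered D x y \<longleftrightarrow> x \<in> W \<and> (\<exists>b\<in>D. is_root b \<and> pos b \<and> y = reflect b \<circ> x) \<and> len y = Suc (len x)"

lemma covered_up: "covered D x y \<Longrightarrow> up x y"
  by (auto simp: covered_def up_def simp del: comp_apply)

lemma covered_mono: "covered D x y \<Longrightarrow> D \<subseteq> D' \<Longrightarrow> covered D' x y"
  by (auto simp: covered_def)

lemma covered_le: "(covered D)\<^sup>*\<^sup>* x y \<Longrightarrow> x \<in> W \<Longrightarrow> le x y"
  by (induction rule: rtranclp_induct) (auto intro: le_refl le_trans covered_up[THEN up_le])

lemma chains_covered: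
  assumes "chains bs u v \<noteq> 0" "u \<in> W" "\<And>b. b \<in> set bs \<Longrightarrow> is_root b \<and> pos b"
  shows "(covered (set bs))\<^sup>*\<^sup>* u v"
  using assms
proof (induction bs arbitrary: u)
  case Nil
  then show ?case by (simp split: if_splits)
next
  case (Cons b bs)
  have mono: "(covered (set (b # bs)))\<^sup>*\<^sup>* x y" if "(covered (set bs))\<^sup>*\<^sup>* x y" for x y
    using that by (rule rtranclp_mono[THEN predicate2D, rotated]) (auto intro: covered_mono)
  from Cons.prems(1) consider "chains bs u v \<noteq> 0"
    | "len (reflect b \<circ> u) = Suc (len u)" "chains bs (reflect b \<circ> u) v \<noteq> 0"
    by (auto simp del: comp_apply split: if_splits)
  then show "(covered (set (b # bs)))\<^sup>*\<^sup>* u v"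
  proof cases
    case 1
    then show ?thesis using Cons by (intro mono) auto
  next
    case 2
    have "covered (set (b # bs)) u (reflect b \<circ> u)"
      using Cons.prems 2 by (auto simp: covered_def simp del: comp_apply)
    moreover have "(covered (set bs))\<^sup>*\<^sup>* (reflect b \<circ> u) v"
      using Cons.prems 2 by (intro Cons.IH) (auto simp del: comp_apply)
    ultimately show ?thesis using mono by (meson converse_rtranclp_into_rtranclp)
  qed
qed

section \<open>Reflection orders adapted to a half-space\<close>

lemma len_elem_rts:
  "w \<in> W \<Longrightarrow> \<forall>b\<in>set (word_roots w xs). pos b \<Longrightarrow> len (w \<circ> elem xs) = len w + length xs"
proof (induction xs arbitrary: w)
  case (Cons s xs)
  then have "pos (w (sroot s))" "len (w \<circ> S s \<circ> elem xs) = len (w \<circ> S s) + length xs"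
    by (simp_all del: comp_apply)
  moreover from this have "len (w \<circ> S s) = Suc (len w)"
    using Cons.prems by (auto elim: len_comp_S_cases[of w s])
  ultimately show "len (w \<circ> elem (s # xs)) = len w + length (s # xs)"
    by (simp add: comp_assoc)
qed simp

text \<open>A letter flips the sign of a root only if it meets that root or its negative, so a
  change from positive to negative happens at a letter whose root is \<open>c\<close>.\<close>

lemma inversion_in_rts:
  assumes "w \<in> W" "is_root c" "pos (inv w c)" "\<not> pos (inv (w \<circ> elem xs) c)"
  shows "c \<in> set (word_roots w xs)"
  using assms
proof (induction xs arbitrary: w)
  case (Cons s xs)
  show "c \<in> set (word_roots w (s # xs))"
  proof (cases "inv w c = sroot s")
    case True
    then show ?thesis using Cons.prems app_inv_W[of w c] by simp
  next
    case False
    then have "pos (inv (w \<circ> S s) c)"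
      using pos_S[of "inv w c" s] Cons.prems by (simp add: inv_comp root_W)
    moreover have "\<not> pos (inv (w \<circ> S s \<circ> elem xs) c)"
      using Cons.prems(4) by (metis elem_Cons comp_assoc)
    ultimately have "c \<in> set (word_roots (w \<circ> S s) xs)"
      using Cons.prems by (intro Cons.IH) (simp_all del: comp_apply)
    then show ?thesis by simp
  qed
qed simp

lemma rts_pos_inv:
  assumes "w \<in> W" "\<forall>b\<in>set (word_roots w xs). pos b" "b \<in> set (word_roots w xs)"
  shows "pos (inv w b)"
  using assms
proof (induction xs arbitrary: w)
  case (Cons s xs)
  then consider "b = w (sroot s)" | "b \<in> set (word_roots (w \<circ> S s) xs)" by auto
  then show ?case
  proof cases
    case 1
    then show ?thesis using Cons.prems by (simp add: inv_app_W)
  next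
    case 2
    have r: "is_root b" using root_rts[of "w \<circ> S s" b xs] Cons.prems 2 by (simp del: comp_apply)
    have "pos (inv (w \<circ> S s) b)"
      using Cons.prems 2 by (intro Cons.IH) (simp_all del: comp_apply)
    then have p: "pos (S s (inv w b))"
      using Cons.prems by (simp add: inv_comp)
    show ?thesis
    proof (rule ccontr)
      assume n: "\<not> pos (inv w b)"
      then have "S s (inv w b) = sroot s"
        using pos_S[of "S s (inv w b)" s] p r Cons.prems(1) by (simp add: root_W) blast
      then have "inv w b = - sroot s" by (metis S_S S_sroot)
      then have "b = - w (sroot s)" using app_inv_W[of w b] Cons.prems(1) by (simp add: W_minus)
      moreover have "pos (w (sroot s))" "pos b" using Cons.prems by (auto simp del: comp_apply)
      ultimately show False using pos_minus[of "w (sroot s)"] Cons.prems(1) by (simp add: root_W)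
    qed
  qed
qed simp

text \<open>Words whose roots are all positive add their length to that of \<open>w\<close>, which
  bounds them in a finite group; a longest one cannot be prolonged.\<close>

lemma exists_maximal_word:
  assumes "finite W" "w \<in> W"
  shows "\<exists>xs. (\<forall>b\<in>set (word_roots w xs). pos b \<and> G b)
    \<and> (\<forall>s. \<not> (pos (w (elem xs (sroot s))) \<and> G (w (elem xs (sroot s)))))"
proof -
  define P where "P n \<longleftrightarrow> (\<exists>xs. length xs = n \<and> (\<forall>b\<in>set (word_roots w xs). pos b \<and> G b))" for n
  have "P 0" by (simp add: P_def)
  moreover have "n \<le> Max (len ` W)" if Pn: "P n" for n
  proof -
    obtain xs where xs: "length xs = n" "\<forall>b\<in>set (word_roots w xs). pos b"
      using Pn unfolding P_def by blast
    then have "n \<le> len (w \<circ> elem xs)" using len_elem_rts[OF assms(2)] by simp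
    also have "\<dots> \<le> Max (len ` W)" using assms by (intro Max_ge) auto
    finally show ?thesis .
  qed
  ultimately obtain n where n: "P n" "\<And>k. P k \<Longrightarrow> k \<le> n"
    using Greatest_le_nat[of P _ "Max (len ` W)"] GreatestI_nat[of P 0 "Max (len ` W)"] by blast
  then obtain xs where xs: "length xs = n" "\<forall>b\<in>set (word_roots w xs). pos b \<and> G b"
    by (auto simp: P_def)
  have False if "pos (w (elem xs (sroot s)))" "G (w (elem xs (sroot s)))" for s
  proof -
    have "P (Suc n)"
      unfolding P_def using xs that by (intro exI[of _ "xs @ [s]"]) (auto simp: rts_append)
    then show False using n(2) by fastforce
  qed
  with xs show ?thesis by blast
qed

text \<open>A reflection order (given by a reduced word of the longest element) listing the roots in
  \<open>G\<close> before the others, where \<open>G\<close> cuts the roots by a half-space.\<close>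

lemma exists_reflection_order:
  assumes fin: "finite W"
    and G: "\<And>b. is_root b \<Longrightarrow> G b \<Longrightarrow> \<not> G (- b)"
    and cone: "\<And>w c. w \<in> W \<Longrightarrow> \<forall>s. \<not> G (w (sroot s)) \<Longrightarrow> is_root c \<Longrightarrow> pos c \<Longrightarrow> pos (w c) \<Longrightarrow> \<not> G (w c)"
  obtains as bs where "\<And>b. b \<in> set as \<union> set bs \<Longrightarrow> is_root b \<and> pos b"
    "\<And>b. b \<in> set as \<Longrightarrow> G b" "\<And>b. b \<in> set bs \<Longrightarrow> \<not> G b"
    "\<And>u v. le u v \<Longrightarrow> chains (as @ bs) u v = 1"
proof -
  obtain xs where xs: "\<forall>b\<in>set (word_roots id xs). pos b \<and> G b"
    "\<forall>s. \<not> (pos (elem xs (sroot s)) \<and> G (elem xs (sroot s)))"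
    using exists_maximal_word[OF fin id_in_W, of G] by auto
  define w where "w = elem xs"
  have w: "w \<in> W" by (simp add: w_def)
  \<comment> \<open>By maximality such a root would be negative. Its negative is then an inversion
    of \<open>w\<close>, hence listed and in \<open>G\<close>, against the antisymmetry of
    \<open>G\<close>.\<close>
  have notG: "\<not> G (w (sroot s))" for s
  proof
    assume g: "G (w (sroot s))"
    let ?c = "- w (sroot s)"
    have r: "is_root (w (sroot s))" using w by (simp add: root_W)
    then have "pos ?c" "is_root ?c" using xs(2) g pos_minus root_minus by (auto simp: w_def)
    moreover have "\<not> pos (inv w ?c)"
      using w by (simp add: W_minus inv_app_W pos_minus)
    ultimately have "?c \<in> set (word_roots id xs)"
      using inversion_in_rts[of id ?c xs] by (simp add: w_def)
    then show False using xs(1) G[OF r g] by blast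
  qed
  \<comment> \<open>The second word continues the first up to a longest element; \<open>cone\<close>
    keeps its roots out of \<open>G\<close>.\<close>
  obtain ys where ys: "\<forall>b\<in>set (word_roots w ys). pos b" "\<forall>s. \<not> pos (w (elem ys (sroot s)))"
    using exists_maximal_word[OF fin w, of "\<lambda>_. True"] by auto
  have nG: "\<not> G b" if "b \<in> set (word_roots w ys)" for b
  proof -
    have "pos (inv w b)" "is_root b" "pos b"
      using rts_pos_inv[OF w ys(1) that] root_rts[OF w that] ys(1) that by auto
    then show ?thesis
      using cone[OF w, of "inv w b"] notG w by (simp add: app_inv_W root_W)
  qed
  have eq: "word_roots id (xs @ ys) = word_roots id xs @ word_roots w ys" by (simp only: rts_append w_def id_comp)
  have "\<forall>b\<in>set (word_roots id (xs @ ys)). pos b" using xs(1) ys(1) by (auto simp: eq)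
  moreover have "longest (elem (xs @ ys))"
    unfolding longest_def using ys(2) by (simp add: w_def)
  ultimately have "chains (word_roots id xs @ word_roots w ys) u v = 1" if "le u v" for u v
    using chains_eq[of "xs @ ys" u v] le_in_W[OF that] that unfolding eq by blast
  moreover have "is_root b \<and> pos b" if "b \<in> set (word_roots id xs) \<union> set (word_roots w ys)" for b
    using that xs(1) ys(1) root_rts[OF id_in_W] root_rts[OF w] by blast
  ultimately show thesis
    using that[of "word_roots id xs" "word_roots w ys"] xs(1) nG by blast
qed

section \<open>Bruhat intervals inside a coset of a stabilizer\<close>

lemma covered_null_comp:
  assumes "linear l" "covered {b. l b = 0} x y" shows "l \<circ> x = l \<circ> y"
  using assms by (auto simp: covered_def fun_eq_iff reflect_def linear_diff linear_scale)

text \<open>If the right multiplicatively invariant relation \<open>f \<circ> x = f \<circ> y\<close> connects the ends of a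
  Bruhat interval along one saturated chain, it holds throughout the interval.  Here \<open>same_cover\<close>
  is a step of such a chain.\<close>

definition same_cover :: "(real^'i \<Rightarrow> 'b) \<Rightarrow> (real^'i \<Rightarrow> real^'i) \<Rightarrow> (real^'i \<Rightarrow> real^'i) \<Rightarrow> bool" where
  "same_cover f x y \<longleftrightarrow> up x y \<and> len y = Suc (len x) \<and> f \<circ> x = f \<circ> y"

lemma same_comp_S: "f \<circ> x = f \<circ> y \<Longrightarrow> f \<circ> (x \<circ> S s) = f \<circ> (y \<circ> S s)"
  by (simp flip: comp_assoc)

text \<open>The chain is projected by \<open>lo s\<close>. If it starts at an ascent of
  \<open>s\<close> and ends at a descent, it crosses in direction \<open>s\<close> somewhere, and
  right invariance carries that equality of \<open>f\<close> back to the start.\<close>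

lemma same_chain_lo:
  assumes "(same_cover f)\<^sup>*\<^sup>* x y" "y \<in> W" "\<not> pos (y (sroot s))"
  shows "(same_cover f)\<^sup>*\<^sup>* (lo s x) (y \<circ> S s) \<and> (pos (x (sroot s)) \<longrightarrow> f \<circ> (x \<circ> S s) = f \<circ> x)"
  using assms(1)
proof (induction rule: converse_rtranclp_induct)
  case base
  then show ?case using assms(3) by (simp add: lo_def)
next
  case (step x x1)
  have u: "up x x1" "len x1 = Suc (len x)" "f \<circ> x = f \<circ> x1"
    using step.hyps by (auto simp: same_cover_def simp del: comp_apply)
  have W: "x \<in> W" "x1 \<in> W" using up_in_W[OF u(1)] by auto
  have fS: "f \<circ> (x \<circ> S s) = f \<circ> (x1 \<circ> S s)" using same_comp_S u(3) by blast
  have l: "len (z \<circ> S s) = (if pos (z (sroot s)) then Suc (len z) else len z - 1)"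
    "pos (z (sroot s)) \<or> len z > 0" if "z \<in> W" for z
    using that by (auto elim!: len_comp_S_cases[of z s] simp del: comp_apply)
  note IH = step.IH
  consider "pos (x (sroot s))" "pos (x1 (sroot s))" | "pos (x (sroot s))" "\<not> pos (x1 (sroot s))"
    | "\<not> pos (x (sroot s))" "\<not> pos (x1 (sroot s))" | "\<not> pos (x (sroot s))" "pos (x1 (sroot s))"
    by blast
  then show ?case
  proof cases
    case 1
    then have "lo s x = x" "lo s x1 = x1" by (simp_all add: lo_def)
    then show ?thesis using IH step.hyps fS u(3) 1
      by (simp del: comp_apply) (meson converse_rtranclp_into_rtranclp)
  next
    case 2
    \<comment> \<open>Right multiplication would give both ends the wrong order of lengths, so this
      cover is the one in direction \<open>s\<close>.\<close>
    then have "\<not> up (x \<circ> S s) (x1 \<circ> S s)"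
      using l[OF W(1)] l[OF W(2)] u(2) by (auto simp: up_def simp del: comp_apply)
    then have x1: "x1 = x \<circ> S s" using up_comp_S[OF u(1)] by blast
    then have "lo s x = x" "lo s x1 = x" using 2 by (simp_all only: lo_def if_True if_False comp_S_S)
    then show ?thesis using IH u(3) x1 by (simp del: comp_apply)
  next
    case 3
    then have "x1 \<noteq> x \<circ> S s" using pos_comp_S[OF W(1)] by blast
    then have "up (x \<circ> S s) (x1 \<circ> S s)" using up_comp_S[OF u(1)] by blast
    then have "same_cover f (x \<circ> S s) (x1 \<circ> S s)"
      unfolding same_cover_def using fS l[OF W(1)] l[OF W(2)] u(2) 3 by (simp del: comp_apply)
    moreover have "lo s x = x \<circ> S s" "lo s x1 = x1 \<circ> S s"
      using 3 by (simp_all only: lo_def if_False)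
    ultimately show ?thesis using IH 3 by (simp del: comp_apply)
  next
    case 4
    \<comment> \<open>The chain crosses again later, so the step from \<open>x \<circ> S s\<close>
      up to \<open>x\<close> is itself a \<open>same_cover\<close> and can be put in front.\<close>
    then have "f \<circ> (x \<circ> S s) = f \<circ> x" using IH fS u(3) by (simp del: comp_apply)
    then have "same_cover f (x \<circ> S s) x"
      unfolding same_cover_def using l[OF W(1)] up_S'[OF W(1)] 4 by (simp del: comp_apply)
    moreover have "lo s x = x \<circ> S s" "lo s x1 = x1"
      using 4 by (simp_all only: lo_def if_False if_True)
    ultimately show ?thesis
      using IH 4 step.hyps(1) by (simp del: comp_apply) (meson converse_rtranclp_into_rtranclp)
  qed
qed

theorem same_interval:
  assumes "(same_cover f)\<^sup>*\<^sup>* x y" "le x z" "le z y"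
  shows "f \<circ> z = f \<circ> x"
  using assms
proof (induction "len y" arbitrary: x y z rule: less_induct)
  case less
  have W: "x \<in> W" "y \<in> W" "z \<in> W" using less.prems(2,3) le_in_W by blast+
  show ?case
  proof (cases "y = id")
    case True
    then have "z = y" "x = y"
      using le_len[OF less.prems(3)] le_len[OF le_trans[OF less.prems(2,3)]] by auto
    then show ?thesis by simp
  next
    case False
    then obtain s where s: "len (y \<circ> S s) < len y" using exists_descent W by blast
    then have ys: "\<not> pos (y (sroot s))" using len_comp_S_greater_iff W by blast
    have chain: "(same_cover f)\<^sup>*\<^sup>* (lo s x) (y \<circ> S s)"
      and xS: "pos (x (sroot s)) \<Longrightarrow> f \<circ> (x \<circ> S s) = f \<circ> x"
      using same_chain_lo[OF less.prems(1) W(2) ys] by blast+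
    have lo_y: "lo s y = y \<circ> S s" using ys by (simp only: lo_def if_False)
    have IH: "f \<circ> z' = f \<circ> lo s x" if "le (lo s x) z'" "le z' (y \<circ> S s)" for z'
      using less.hyps[OF s chain that] .
    \<comment> \<open>All three elements are projected by \<open>lo s\<close>, which replaces
      \<open>y\<close> by the shorter \<open>y \<circ> S s\<close>.\<close>
    have loz: "f \<circ> lo s z = f \<circ> lo s x"
      using IH le_lo[OF less.prems(2), of s] le_lo[OF less.prems(3), of s] unfolding lo_y by blast
    show ?thesis
    proof (cases "pos (x (sroot s))")
      case True
      then have lox: "lo s x = x" by (simp only: lo_def if_True)
      show ?thesis
      proof (cases "pos (z (sroot s))")
        case True
        then show ?thesis using loz lox by (simp only: lo_def if_True)
      next
        case False
        then have "f \<circ> (z \<circ> S s) = f \<circ> x" using loz lox by (simp only: lo_def if_False)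
        then have "f \<circ> (z \<circ> S s \<circ> S s) = f \<circ> (x \<circ> S s)" by (rule same_comp_S)
        then show ?thesis using xS[OF \<open>pos (x (sroot s))\<close>] by (simp only: comp_S_S)
      qed
    next
      case False
      then have lox: "lo s x = x \<circ> S s" by (simp only: lo_def if_False)
      show ?thesis
      proof (cases "pos (z (sroot s))")
        case True
        then have loz': "lo s z = z" by (simp only: lo_def if_True)
        \<comment> \<open>Now \<open>x\<close> lies below \<open>z\<close>, hence in the projected
          interval, and the induction hypothesis applies to \<open>x\<close> itself.\<close>
        have "le z (y \<circ> S s)" using le_lo[OF less.prems(3), of s] unfolding loz' lo_y .
        then have "f \<circ> x = f \<circ> lo s x"
          using IH[of x] le_S'[OF W(1) False] le_trans[OF less.prems(2)] unfolding lox by blast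
        then show ?thesis using loz loz' by simp
      next
        case False
        then have "f \<circ> (z \<circ> S s) = f \<circ> (x \<circ> S s)" using loz lox by (simp only: lo_def if_False)
        then have "f \<circ> (z \<circ> S s \<circ> S s) = f \<circ> (x \<circ> S s \<circ> S s)" by (rule same_comp_S)
        then show ?thesis by (simp only: comp_S_S)
      qed
    qed
  qed
qed

subsection \<open>Linear functionals on orbits\<close>

definition antidominant :: "real^'i \<Rightarrow> bool" where
  "antidominant p \<longleftrightarrow> (\<forall>s. B p (sroot s) < 0)"

lemma antidominant_neg:
  assumes "antidominant p" "is_root c" "pos c"
  shows "B c p < 0"
proof -
  let ?g = "\<lambda>a. (c $ a) * - B p (sroot a)"
  have e: "B c p = - (\<Sum>a\<in>UNIV. ?g a)"
    unfolding B_sym[of c p] linear_sroot_sum[OF linear_B, of p c] by (simp add: sum_negf)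
  have nn: "?g a \<ge> 0" for a
    using assms by (intro mult_nonneg_nonneg) (auto simp: antidominant_def pos_def less_imp_le)
  have "(\<Sum>a\<in>UNIV. ?g a) \<noteq> 0"
  proof
    assume "(\<Sum>a\<in>UNIV. ?g a) = 0"
    then have "\<forall>a. ?g a = 0" using sum_nonneg_eq_0_iff[of UNIV ?g] nn by simp
    moreover have "B p (sroot a) \<noteq> 0" for a using assms(1) by (auto simp: antidominant_def less_le)
    ultimately have "c = 0" by (simp add: vec_eq_iff)
    then show False using B_root[OF assms(2)] linear_0[OF linear_B] by simp
  qed
  then show ?thesis using e sum_nonneg[of UNIV ?g] nn by (simp add: less_le)
qed

text \<open>Going up an edge labelled \<open>b\<close> moves the orbit point by a positive multiple
  of \<open>b\<close>, since \<open>B b (x p) = B (inv x b) p\<close> is negative. The sign of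
  \<open>l b\<close> thus decides whether \<open>l\<close> rises or falls.\<close>

lemma covered_functional:
  fixes l :: "real^'i \<Rightarrow> real"
  assumes "linear l" "antidominant p" "covered D x y"
  obtains b c where "b \<in> D" "c > 0" "l (y p) = l (x p) + c * l b" "covered {b} x y"
proof -
  obtain b where b: "x \<in> W" "b \<in> D" "is_root b" "pos b" "y = reflect b \<circ> x" "len y = Suc (len x)"
    using assms(3) by (auto simp: covered_def)
  then have "pos (inv x b)" using len_less_refl_iff[of b x] by simp
  then have "B (inv x b) p < 0" using antidominant_neg assms b by (simp add: root_W)
  moreover have "B b (x p) = B (inv x b) p"
    using B_W[OF b(1), of "inv x b" p] b by (simp add: app_inv_W)
  moreover have "l (y p) = l (x p) + (- 2 * B b (x p)) * l b"
    using assms(1) b by (simp add: reflect_def linear_diff linear_scale)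
  moreover have "covered {b} x y" using b by (simp add: covered_def)
  ultimately show thesis using that[of b "- 2 * B b (x p)"] b by simp
qed

lemma covered_path_mono:
  fixes l :: "real^'i \<Rightarrow> real"
  assumes "linear l" "antidominant p" "(covered D)\<^sup>*\<^sup>* x y" "\<And>b. b \<in> D \<Longrightarrow> l b \<ge> 0"
  shows "l (x p) \<le> l (y p) \<and> (l (x p) = l (y p) \<longrightarrow> (covered {b \<in> D. l b = 0})\<^sup>*\<^sup>* x y)"
  using assms(3)
proof (induction rule: rtranclp_induct)
  case (step y z)
  obtain b c where b: "b \<in> D" "c > 0" "l (z p) = l (y p) + c * l b" "covered {b} y z"
    using covered_functional[OF assms(1,2) step.hyps(2)] by blast
  then have "c * l b \<ge> 0" using assms(4)[of b] by simp
  moreover have "covered {b \<in> D. l b = 0} y z" if "c * l b = 0"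
    using b that by (auto intro: covered_mono[OF b(4)])
  ultimately show ?case
    using step.IH b(3) by (auto intro: rtranclp.rtrancl_into_rtrancl)
qed simp

lemma covered_empty: "(covered {})\<^sup>*\<^sup>* x y \<Longrightarrow> x = y"
  by (induction rule: rtranclp_induct) (auto simp: covered_def)

lemma covered_path_strict:
  fixes l :: "real^'i \<Rightarrow> real"
  assumes "linear l" "antidominant p" "(covered D)\<^sup>*\<^sup>* x y" "\<And>b. b \<in> D \<Longrightarrow> l b > 0"
  shows "l (x p) \<le> l (y p)" "l (x p) = l (y p) \<Longrightarrow> x = y"
proof -
  have e: "{b \<in> D. l b = 0} = {}" using assms(4) less_irrefl by (metis (mono_tags, lifting) Collect_empty_eq)
  have "l (x p) \<le> l (y p) \<and> (l (x p) = l (y p) \<longrightarrow> (covered {})\<^sup>*\<^sup>* x y)"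
    using covered_path_mono[OF assms(1-3)] assms(4) unfolding e by (simp add: less_imp_le)
  then show "l (x p) \<le> l (y p)" "l (x p) = l (y p) \<Longrightarrow> x = y"
    using covered_empty by blast+
qed

lemma covered_path_antimono:
  fixes l :: "real^'i \<Rightarrow> real"
  assumes "linear l" "antidominant p" "(covered D)\<^sup>*\<^sup>* x y" "\<And>b. b \<in> D \<Longrightarrow> l b \<le> 0"
  shows "l (y p) \<le> l (x p)"
  using covered_path_mono[of "\<lambda>v. - l v" p D x y, OF linear_compose_neg[OF assms(1)] assms(2,3)]
    assms(4) by simp

lemma covered_path_antistrict:
  fixes l :: "real^'i \<Rightarrow> real"
  assumes "linear l" "antidominant p" "(covered D)\<^sup>*\<^sup>* x y" "\<And>b. b \<in> D \<Longrightarrow> l b < 0"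
  shows "l (y p) \<le> l (x p)" "l (x p) = l (y p) \<Longrightarrow> x = y"
  using covered_path_strict[of "\<lambda>v. - l v" p D x y, OF linear_compose_neg[OF assms(1)] assms(2,3)]
    assms(4) by simp_all

section \<open>Minimizers of a functional on a Bruhat interval\<close>

lemma unique_split:
  assumes fin: "finite W" and roots: "\<And>b. b \<in> set as \<union> set bs \<Longrightarrow> is_root b \<and> pos b"
    and chains: "chains (as @ bs) u v = 1" and u: "u \<in> W"
  shows "\<exists>!z. z \<in> W \<and> chains as u z \<noteq> 0 \<and> chains bs z v \<noteq> 0"
proof -
  have "(\<Sum>z\<in>W. chains as u z * chains bs z v) = 1"
    using sum_chains[OF fin u, of as bs v] roots chains by simp
  \<comment> \<open>A sum of natural numbers equals 1 only if exactly one term is nonzero.\<close>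
  then obtain a where a: "a \<in> W" "chains as u a * chains bs a v = 1"
    "\<forall>z\<in>W. a \<noteq> z \<longrightarrow> chains as u z * chains bs z v = 0"
    using sum_eq_1_iff[OF fin, of "\<lambda>z. chains as u z * chains bs z v"] by auto
  then show ?thesis
    by (intro ex1I[of _ a]) auto
qed

lemma functional_combination:
  fixes l :: "real^'i \<Rightarrow> real"
  shows "linear l \<Longrightarrow> w \<in> W \<Longrightarrow> l (w c) = (\<Sum>a\<in>UNIV. (c $ a) * l (w (sroot a)))"
  using linear_sroot_sum[OF linear_compose[OF linear_W], of w l c] by simp

lemma minimizers_have_least:
  fixes l :: "real^'i \<Rightarrow> real"
  assumes fin: "finite W" and l: "linear l" and p: "antidominant p" and uv: "le u v"
    and M: "\<And>z. le u z \<Longrightarrow> le z v \<Longrightarrow> M \<le> l (z p)"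
    and A: "A = {z. le u z \<and> le z v \<and> l (z p) = M}" "A \<noteq> {}"
  shows "\<exists>x\<in>A. \<forall>z\<in>A. (covered {b. l b = 0})\<^sup>*\<^sup>* x z"
proof -
  obtain as bs where o: "\<And>b. b \<in> set as \<union> set bs \<Longrightarrow> is_root b \<and> pos b"
    "\<And>b. b \<in> set as \<Longrightarrow> l b < 0" "\<And>b. b \<in> set bs \<Longrightarrow> \<not> l b < 0"
    "\<And>u v. le u v \<Longrightarrow> chains (as @ bs) u v = 1"
  proof (rule exists_reflection_order[OF fin, of "\<lambda>b. l b < 0"])
    show "\<not> l (- b) < 0" if "l b < 0" for b using that l by (simp add: linear_neg)
    show "\<not> l (w c) < 0" if "w \<in> W" "\<forall>s. \<not> l (w (sroot s)) < 0" "pos c" for w c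
      unfolding functional_combination[OF l that(1), of c] not_less
      using that by (intro sum_nonneg mult_nonneg_nonneg) (auto simp: pos_def not_less)
  qed blast
  have pa: "le x y \<and> l (y p) \<le> l (x p) \<and> (l (x p) = l (y p) \<longrightarrow> x = y)"
    if "chains as x y \<noteq> 0" "x \<in> W" for x y
  proof -
    have c: "(covered (set as))\<^sup>*\<^sup>* x y" using chains_covered[OF that] o(1) by blast
    show ?thesis using covered_path_antistrict[OF l p c o(2)] covered_le[OF c that(2)] by blast
  qed
  have pb: "le x y \<and> l (x p) \<le> l (y p) \<and> (l (x p) = l (y p) \<longrightarrow> (covered {b. l b = 0})\<^sup>*\<^sup>* x y)"
    if "chains bs x y \<noteq> 0" "x \<in> W" for x y
  proof -
    have c: "(covered (set bs))\<^sup>*\<^sup>* x y" using chains_covered[OF that] o(1) by blast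
    have "(covered {b. l b = 0})\<^sup>*\<^sup>* x y" if "(covered {b \<in> set bs. l b = 0})\<^sup>*\<^sup>* x y"
      using that by (rule rtranclp_mono[THEN predicate2D, rotated]) (auto intro: covered_mono)
    then show ?thesis
      using covered_path_mono[OF l p c] o(3) covered_le[OF c that(2)] by (auto simp: not_less)
  qed
  have split: "\<exists>!z. z \<in> W \<and> chains as x z \<noteq> 0 \<and> chains bs z y \<noteq> 0" if "le x y" for x y
    using unique_split[OF fin o(1) o(4)[OF that]] le_in_W[OF that] by blast
  obtain x where x: "\<And>z. z \<in> W \<Longrightarrow> chains as u z \<noteq> 0 \<Longrightarrow> chains bs z v \<noteq> 0 \<Longrightarrow> z = x"
    using split[OF uv] by blast
  \<comment> \<open>The first half of the chain from \<open>z\<close> to \<open>v\<close> strictly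
    decreases \<open>l\<close>, so at a minimizer it is trivial.\<close>
  have top: "chains bs z v \<noteq> 0" if "z \<in> A" for z
  proof -
    have z: "le u z" "le z v" "l (z p) = M" "z \<in> W" using that A le_in_W by auto
    obtain z' where z': "z' \<in> W" "chains as z z' \<noteq> 0" "chains bs z' v \<noteq> 0"
      using split[OF z(2)] by blast
    then have "le u z'" "le z' v" using pa[OF z'(2) z(4)] pb[OF z'(3,1)] z le_trans by blast+
    then have "z = z'" using M[of z'] pa[OF z'(2) z(4)] z(3) by simp
    then show ?thesis using z' by simp
  qed
  \<comment> \<open>The turning point of the chain from \<open>u\<close> to \<open>z\<close> is
    again a minimizer. With \<open>top\<close> it is also the turning point of the chain from
    \<open>u\<close> to \<open>v\<close>, which is \<open>x\<close>.\<close>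
  have bottom: "x \<in> A \<and> (covered {b. l b = 0})\<^sup>*\<^sup>* x z" if "z \<in> A" for z
  proof -
    have z: "le u z" "le z v" "l (z p) = M" "z \<in> W" "u \<in> W" using that A le_in_W by auto
    obtain z' where z': "z' \<in> W" "chains as u z' \<noteq> 0" "chains bs z' z \<noteq> 0"
      using split[OF z(1)] by blast
    then have le: "le u z'" "le z' v" using pa[OF z'(2) z(5)] pb[OF z'(3,1)] z le_trans by blast+
    then have "l (z' p) = M" using M[of z'] pb[OF z'(3,1)] z(3) by simp
    then have "z' \<in> A" "(covered {b. l b = 0})\<^sup>*\<^sup>* z' z" using A le pb[OF z'(3,1)] z(3) by auto
    moreover have "z' = x" using x[OF z'(1,2)] top[OF \<open>z' \<in> A\<close>] by blast
    ultimately show ?thesis by simp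
  qed
  then show ?thesis using A(2) by blast
qed

text \<open>The positive roots with \<open>l b = 0\<close> now belong to the first half, so it is
  the second half that is strictly monotone. Requiring \<open>pos b\<close> in the tie keeps
  \<open>?G\<close> antisymmetric.\<close>

lemma minimizers_have_greatest:
  fixes l :: "real^'i \<Rightarrow> real"
  assumes fin: "finite W" and l: "linear l" and p: "antidominant p" and uv: "le u v"
    and M: "\<And>z. le u z \<Longrightarrow> le z v \<Longrightarrow> M \<le> l (z p)"
    and A: "A = {z. le u z \<and> le z v \<and> l (z p) = M}" "A \<noteq> {}"
  shows "\<exists>y\<in>A. \<forall>z\<in>A. le z y"
proof -
  let ?G = "\<lambda>b. l b < 0 \<or> l b = 0 \<and> pos b"
  obtain as bs where o: "\<And>b. b \<in> set as \<union> set bs \<Longrightarrow> is_root b \<and> pos b"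
    "\<And>b. b \<in> set as \<Longrightarrow> ?G b" "\<And>b. b \<in> set bs \<Longrightarrow> \<not> ?G b"
    "\<And>u v. le u v \<Longrightarrow> chains (as @ bs) u v = 1"
  proof (rule exists_reflection_order[OF fin, of ?G])
    show "\<not> ?G (- b)" if "is_root b" "?G b" for b
      using that l pos_minus[of b] by (auto simp: linear_neg)
    show "\<not> ?G (w c)" if w: "w \<in> W" and s: "\<forall>s. \<not> ?G (w (sroot s))"
      and c: "is_root c" "pos c" "pos (w c)" for w c
    proof -
      have nn: "0 \<le> c $ a * l (w (sroot a))" for a
        using s c by (intro mult_nonneg_nonneg) (auto simp: pos_def not_less)
      \<comment> \<open>Otherwise every simple root in the support of \<open>c\<close> ties, so its
        image is negative, and \<open>w c\<close> would be negative too.\<close>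
      have "l (w c) \<noteq> 0"
      proof
        assume "l (w c) = 0"
        then have z: "c $ a * l (w (sroot a)) = 0" for a
          using nn sum_nonneg_eq_0_iff[of UNIV "\<lambda>a. c $ a * l (w (sroot a))"]
          unfolding functional_combination[OF l w, of c] by simp
        have "(c $ a *\<^sub>R w (sroot a)) $ i \<le> 0" for a i
        proof (cases "c $ a = 0")
          case False
          then have "\<not> pos (w (sroot a))" using z[of a] s by auto
          then have "pos (- w (sroot a))" using pos_minus[of "w (sroot a)"] w by (simp add: root_W)
          then have "w (sroot a) $ i \<le> 0" by (simp add: pos_def)
          then show ?thesis using c by (simp add: pos_def mult_nonneg_nonpos)
        qed simp
        then have "w c $ i \<le> 0" for i
          unfolding linear_sroot_sum[OF linear_W[OF w], of c] sum_component by (intro sum_nonpos)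
        then have "pos (- w c)" by (simp add: pos_def)
        then show False using pos_minus[of "w c"] c w by (simp add: root_W)
      qed
      moreover have "l (w c) \<ge> 0" unfolding functional_combination[OF l w, of c] using nn by (rule sum_nonneg)
      ultimately show ?thesis by simp
    qed
  qed blast
  have pa: "le x y \<and> l (y p) \<le> l (x p)" if "chains as x y \<noteq> 0" "x \<in> W" for x y
  proof -
    have c: "(covered (set as))\<^sup>*\<^sup>* x y" using chains_covered[OF that] o(1) by blast
    have "l b \<le> 0" if "b \<in> set as" for b using o(2)[OF that] by auto
    then show ?thesis using covered_path_antimono[OF l p c] covered_le[OF c that(2)] by blast
  qed
  have pb: "le x y \<and> l (x p) \<le> l (y p) \<and> (l (x p) = l (y p) \<longrightarrow> x = y)"
    if "chains bs x y \<noteq> 0" "x \<in> W" for x y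
  proof -
    have c: "(covered (set bs))\<^sup>*\<^sup>* x y" using chains_covered[OF that] o(1) by blast
    have "l b > 0" if "b \<in> set bs" for b using o(1,3) that by force
    then show ?thesis using covered_path_strict[OF l p c] covered_le[OF c that(2)] by blast
  qed
  have split: "\<exists>!z. z \<in> W \<and> chains as x z \<noteq> 0 \<and> chains bs z y \<noteq> 0" if "le x y" for x y
    using unique_split[OF fin o(1) o(4)[OF that]] le_in_W[OF that] by blast
  obtain y where y: "\<And>z. z \<in> W \<Longrightarrow> chains as u z \<noteq> 0 \<Longrightarrow> chains bs z v \<noteq> 0 \<Longrightarrow> z = y"
    using split[OF uv] by blast
  have bottom: "chains as u z \<noteq> 0" if "z \<in> A" for z
  proof -
    have z: "le u z" "le z v" "l (z p) = M" "u \<in> W" using that A le_in_W by auto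
    obtain z' where z': "z' \<in> W" "chains as u z' \<noteq> 0" "chains bs z' z \<noteq> 0"
      using split[OF z(1)] by blast
    then have "le u z'" "le z' v" using pa[OF z'(2) z(4)] pb[OF z'(3,1)] z le_trans by blast+
    then have "z' = z" using M[of z'] pb[OF z'(3,1)] z(3) by simp
    then show ?thesis using z' by simp
  qed
  have top: "y \<in> A \<and> le z y" if "z \<in> A" for z
  proof -
    have z: "le u z" "le z v" "l (z p) = M" "z \<in> W" using that A le_in_W by auto
    obtain z' where z': "z' \<in> W" "chains as z z' \<noteq> 0" "chains bs z' v \<noteq> 0"
      using split[OF z(2)] by blast
    then have le: "le u z'" "le z' v" "le z z'"
      using pa[OF z'(2) z(4)] pb[OF z'(3,1)] z le_trans by blast+
    then have "l (z' p) = M" using M[of z'] pa[OF z'(2) z(4)] z(3) by simp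
    then have "z' \<in> A" using A le by simp
    moreover have "z' = y" using y[OF z'(1) bottom[OF \<open>z' \<in> A\<close>] z'(3)] .
    ultimately show ?thesis using le by simp
  qed
  then show ?thesis using A(2) by blast
qed

theorem minimizers_interval:
  fixes l :: "real^'i \<Rightarrow> real"
  assumes fin: "finite W" and l: "linear l" and p: "antidominant p" and uv: "le u v"
    and M: "\<And>z. le u z \<Longrightarrow> le z v \<Longrightarrow> M \<le> l (z p)"
    and A: "A = {z. le u z \<and> le z v \<and> l (z p) = M}" "A \<noteq> {}"
  obtains x y where "le u x" "le x y" "le y v" "A = bruhat_interval m x y"
proof -
  obtain x where x: "x \<in> A" "\<And>z. z \<in> A \<Longrightarrow> (covered {b. l b = 0})\<^sup>*\<^sup>* x z"
    using minimizers_have_least[where l = l and p = p and u = u and v = v and M = M and A = A] assms by blast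
  obtain y where y: "y \<in> A" "\<And>z. z \<in> A \<Longrightarrow> le z y"
    using minimizers_have_greatest[where l = l and p = p and u = u and v = v and M = M and A = A] assms by blast
  \<comment> \<open>Reflections in roots killed by \<open>l\<close> do not change \<open>l\<close>,
    so the path from \<open>x\<close> to \<open>y\<close> meets the hypothesis of
    \<open>same_interval\<close>.\<close>
  have "same_cover l a b" if "covered {b. l b = 0} a b" for a b
    using that covered_null_comp[OF l that] covered_up[OF that]
    by (simp add: same_cover_def covered_def del: comp_apply)
  then have chain: "(same_cover l)\<^sup>*\<^sup>* x y"
    using x(2)[OF y(1)] rtranclp_mono[of "covered {b. l b = 0}" "same_cover l"] by blast
  have xW: "x \<in> W" using x(1) A(1) le_in_W by blast
  have "z \<in> A" if "le x z" "le z y" for z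
  proof -
    have "l \<circ> z = l \<circ> x" using same_interval[OF chain that] .
    then have "l (z p) = l (x p)" by (simp add: fun_eq_iff)
    then show ?thesis using x(1) y(1) that A(1) le_trans by auto
  qed
  moreover have "le x z" if "z \<in> A" for z using covered_le[OF x(2)[OF that] xW] .
  ultimately have "A = bruhat_interval m x y" using y(2) by (auto simp: bruhat_interval_def)
  moreover have "le u x" "le x y" "le y v"
    using x(1) y A(1) covered_le[OF x(2)[OF y(1)] xW] by auto
  ultimately show thesis using that by blast
qed

end

section \<open>From faces to sets of minimizers\<close>

theorem theorem5p1:
  fixes m :: "'i::finite \<Rightarrow> 'i \<Rightarrow> nat" and u v :: "real^'i \<Rightarrow> real^'i"
    and p :: "real^'i" and F :: "(real^'i) set"
  assumes "coxeter_matrix m"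
    and "finite (coxW m)"
    and "\<forall>s. cform m p (sroot s) < 0"
    and "bruhat_le m u v"
    and "F face_of BIP m u v p" and "F \<noteq> {}"
  shows "\<exists>x y. bruhat_le m u x \<and> bruhat_le m x y \<and> bruhat_le m y v \<and> F = BIP m x y p"
proof -
  interpret coxeter_rep m by unfold_locales (rule assms(1))
  define V where "V = (\<lambda>z. z p) ` bruhat_interval m u v"
  have "bruhat_interval m u v \<subseteq> W" using le_in_W by (auto simp: bruhat_interval_def)
  then have finV: "finite V" using assms(2) finite_subset by (auto simp: V_def)
  have face: "F face_of convex hull V" using assms(5) by (simp add: BIP_def V_def)
  obtain S' where S': "S' \<subseteq> V" "F = convex hull S'"
    using face_of_convex_hull_subset[OF finite_imp_compact[OF finV] face] by blast
  \<comment> \<open>Every face of a polyhedron is cut out by a supporting hyperplane.\<close>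
  have "F exposed_face_of convex hull V"
    using face exposed_face_of_polyhedron[OF polytope_imp_polyhedron[OF polytope_convex_hull[OF finV]]]
    by blast
  then obtain a b where ab: "convex hull V \<subseteq> {x. a \<bullet> x \<le> b}" "F = convex hull V \<inter> {x. a \<bullet> x = b}"
    unfolding exposed_face_of_def by blast
  \<comment> \<open>The face is where \<open>a\<close> is maximal, whereas
    \<open>minimizers_interval\<close> deals with minima.\<close>
  define l where "l x = - (a \<bullet> x)" for x
  have l: "linear l" unfolding l_def by (intro linearI) (simp_all add: inner_add_right)
  define A where "A = {z. le u z \<and> le z v \<and> l (z p) = - b}"
  have V: "z p \<in> convex hull V" if "le u z" "le z v" for z
    using that by (intro hull_inc) (auto simp: V_def bruhat_interval_def)
  \<comment> \<open>A face is the hull of the generators it contains, and those in \<open>F\<close>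
    are the orbit points of \<open>A\<close>.\<close>
  have VF: "V \<inter> F = (\<lambda>z. z p) ` A"
    using V unfolding ab(2) by (auto simp: V_def A_def l_def bruhat_interval_def)
  have FA: "F = convex hull ((\<lambda>z. z p) ` A)"
  proof
    have "S' \<subseteq> F" using S'(2) by (simp add: hull_subset)
    then show "F \<subseteq> convex hull ((\<lambda>z. z p) ` A)"
      unfolding S'(2) using S'(1) VF by (intro hull_mono) (auto simp: S'(2))
    show "convex hull ((\<lambda>z. z p) ` A) \<subseteq> F"
      unfolding VF[symmetric] using face_of_imp_convex[OF face] by (intro hull_minimal) auto
  qed
  with assms(6) have "A \<noteq> {}" by auto
  moreover have "- b \<le> l (z p)" if "le u z" "le z v" for z
    using V[OF that] ab(1) by (auto simp: l_def)
  moreover have "antidominant p" using assms(3) by (simp add: antidominant_def)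
  ultimately obtain x y where "le u x" "le x y" "le y v" "A = bruhat_interval m x y"
    using minimizers_interval[where l = l and p = p and u = u and v = v and M = "- b" and A = A]
      assms(2,4) l A_def by blast
  then show ?thesis using FA by (auto simp: BIP_def)
qed

end
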